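(* Let $R$ be a commutative ring with unity, $I$ a proper ideal of $R$ and $a,b\in R$. Assume that $I$ is a regular ideal. Then the rings $R(I)_{a,b}$ and $R[t]/(t^2+at+b)$ have the same total ring of fractions and the same integral closure.
   Context: The Rees algebra of $R$ with respect to $I$ is $\mathcal R_+=\bigoplus_{n\ge 0} I^nt^n\subseteq R[t]$. For $a,b\in R$, let $(I^2(t^2+at+b))$ denote the ideal $(t^2+at+b)R[t]\cap \mathcal R_+$ of $\mathcal R_+$, and set $R(I)_{a,b}=\mathcal R_+/(I^2(t^2+at+b))$. Each element of $R(I)_{a,b}$ is uniquely represented by a polynomial $r+it$ with $r\in R$, $i\in I$; $R(I)_{a,b}$ is naturally a subring of $R[t]/(t^2+at+b)$, and the coincidence of total rings of fractions is understood via this inclusion. The integral closure of a ring is taken in its total ring of fractions. A regular ideal is an ideal containing a regular element (non-zero-divisor). *)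

theory Defs
  imports "HOL-Algebra.UnivPoly" "HOL-Algebra.QuotRing" "HOL-Algebra.Ideal_Product"
    "HOL-Algebra.Subrings"
begin

section \<open>Total rings of fractions\<close>

definition regular_elems :: "('a, 'm) ring_scheme \<Rightarrow> 'a set"
  where "regular_elems A =
    {s \<in> carrier A. \<forall>x \<in> carrier A. s \<otimes>\<^bsub>A\<^esub> x = \<zero>\<^bsub>A\<^esub> \<longrightarrow> x = \<zero>\<^bsub>A\<^esub>}"

definition frac_rel :: "('a, 'm) ring_scheme \<Rightarrow> (('a \<times> 'a) \<times> ('a \<times> 'a)) set"
  where "frac_rel A = {((x, s), (y, u)).
    x \<in> carrier A \<and> s \<in> regular_elems A \<and> y \<in> carrier A \<and> u \<in> regular_elems A \<and>
    x \<otimes>\<^bsub>A\<^esub> u = y \<otimes>\<^bsub>A\<^esub> s}"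

text \<open>The fraction \<open>x / s\<close>.\<close>

definition frac_of :: "('a, 'm) ring_scheme \<Rightarrow> 'a \<Rightarrow> 'a \<Rightarrow> ('a \<times> 'a) set"
  where "frac_of A x s = frac_rel A `` {(x, s)}"

definition total_frac :: "('a, 'm) ring_scheme \<Rightarrow> ('a \<times> 'a) set ring"
  where "total_frac A = \<lparr>
    carrier = (carrier A \<times> regular_elems A) // frac_rel A,
    mult = (\<lambda>V W. \<Union>p \<in> V. \<Union>q \<in> W.
      frac_of A (fst p \<otimes>\<^bsub>A\<^esub> fst q) (snd p \<otimes>\<^bsub>A\<^esub> snd q)),
    one = frac_of A \<one>\<^bsub>A\<^esub> \<one>\<^bsub>A\<^esub>,
    zero = frac_of A \<zero>\<^bsub>A\<^esub> \<one>\<^bsub>A\<^esub>,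
    add = (\<lambda>V W. \<Union>p \<in> V. \<Union>q \<in> W.
      frac_of A ((fst p \<otimes>\<^bsub>A\<^esub> snd q) \<oplus>\<^bsub>A\<^esub> (fst q \<otimes>\<^bsub>A\<^esub> snd p))
        (snd p \<otimes>\<^bsub>A\<^esub> snd q))\<rparr>"

definition to_total_frac :: "('a, 'm) ring_scheme \<Rightarrow> 'a \<Rightarrow> ('a \<times> 'a) set"
  where "to_total_frac A x = frac_of A x \<one>\<^bsub>A\<^esub>"

text \<open>Elements of \<open>Q\<close> that are roots of a monic polynomial over \<open>A\<close>, where \<open>A\<close> acts on \<open>Q\<close>
  through the ring homomorphism \<open>h\<close>.\<close>

definition integral_over ::
    "('a, 'm) ring_scheme \<Rightarrow> ('b, 'n) ring_scheme \<Rightarrow> ('a \<Rightarrow> 'b) \<Rightarrow> 'b \<Rightarrow> bool"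
  where "integral_over A Q h z \<longleftrightarrow> z \<in> carrier Q \<and>
    (\<exists>p \<in> carrier (UP A). coeff (UP A) p (deg A p) = \<one>\<^bsub>A\<^esub> \<and> eval A Q h z p = \<zero>\<^bsub>Q\<^esub>)"

definition integral_closure :: "('a, 'm) ring_scheme \<Rightarrow> ('a \<times> 'a) set set"
  where "integral_closure A = {z. integral_over A (total_frac A) (to_total_frac A) z}"

section \<open>The rings in question\<close>

text \<open>The powers \<open>I ^ n\<close> are taken in the monoid of ideals, so that \<open>I ^ 0\<close> is the whole ring.\<close>

definition rees_algebra :: "('a, 'm) ring_scheme \<Rightarrow> 'a set \<Rightarrow> ('a, nat \<Rightarrow> 'a) up_ring"
  where "rees_algebra R I = (UP R)\<lparr>carrier :=
    {p \<in> carrier (UP R). \<forall>n. coeff (UP R) p n \<in> I [^]\<^bsub>ideals_set R\<^esub> n}\<rparr>"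

definition quad_poly :: "('a, 'm) ring_scheme \<Rightarrow> 'a \<Rightarrow> 'a \<Rightarrow> nat \<Rightarrow> 'a"
  where "quad_poly R a b =
    monom (UP R) \<one>\<^bsub>R\<^esub> 2 \<oplus>\<^bsub>UP R\<^esub> monom (UP R) a 1 \<oplus>\<^bsub>UP R\<^esub> monom (UP R) b 0"

definition quad_ideal :: "('a, 'm) ring_scheme \<Rightarrow> 'a \<Rightarrow> 'a \<Rightarrow> (nat \<Rightarrow> 'a) set"
  where "quad_ideal R a b = PIdl\<^bsub>UP R\<^esub> (quad_poly R a b)"

definition quad_ext :: "('a, 'm) ring_scheme \<Rightarrow> 'a \<Rightarrow> 'a \<Rightarrow> (nat \<Rightarrow> 'a) set ring"
  where "quad_ext R a b = UP R Quot quad_ideal R a b"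

definition rees_quot :: "('a, 'm) ring_scheme \<Rightarrow> 'a set \<Rightarrow> 'a \<Rightarrow> 'a \<Rightarrow> (nat \<Rightarrow> 'a) set ring"
  where "rees_quot R I a b =
    rees_algebra R I Quot (quad_ideal R a b \<inter> carrier (rees_algebra R I))"

text \<open>The inclusion of \<^const>\<open>rees_quot\<close> in \<^const>\<open>quad_ext\<close> induced by the inclusion of the Rees
  algebra in the polynomial ring: the coset \<open>V\<close> of the smaller ideal is sent to the coset
  \<open>quad_ideal R a b + V\<close> of the larger one (see \<open>rees_incl_coset\<close> below).\<close>

definition rees_incl ::
    "('a, 'm) ring_scheme \<Rightarrow> 'a \<Rightarrow> 'a \<Rightarrow> (nat \<Rightarrow> 'a) set \<Rightarrow> (nat \<Rightarrow> 'a) set"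
  where "rees_incl R a b V = quad_ideal R a b <+>\<^bsub>UP R\<^esub> V"

section \<open>Well-definedness\<close>

context cring
begin

lemma regular_elems_closed: "s \<in> regular_elems R \<Longrightarrow> s \<in> carrier R"
  by (simp add: regular_elems_def)

lemma regular_elemsD:
  "\<lbrakk>s \<in> regular_elems R; x \<in> carrier R; s \<otimes> x = \<zero>\<rbrakk> \<Longrightarrow> x = \<zero>"
  unfolding regular_elems_def by blast

lemma regular_elems_one: "\<one> \<in> regular_elems R"
  by (simp add: regular_elems_def)

lemma regular_elems_mult:
  assumes "s \<in> regular_elems R" "u \<in> regular_elems R"
  shows "s \<otimes> u \<in> regular_elems R"
proof -
  have su: "s \<in> carrier R" "u \<in> carrier R" using assms by (simp_all add: regular_elems_closed)
  have "x = \<zero>" if "x \<in> carrier R" "(s \<otimes> u) \<otimes> x = \<zero>" for x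
  proof -
    have "s \<otimes> (u \<otimes> x) = \<zero>" using that su by (simp add: m_assoc)
    then have "u \<otimes> x = \<zero>" using regular_elemsD[OF assms(1)] that su by blast
    then show ?thesis using regular_elemsD[OF assms(2)] that by blast
  qed
  then show ?thesis using su unfolding regular_elems_def by blast
qed

lemma regular_elems_cancel:
  assumes "s \<in> regular_elems R" "x \<in> carrier R" "y \<in> carrier R" "s \<otimes> x = s \<otimes> y"
  shows "x = y"
proof -
  have s: "s \<in> carrier R" using assms(1) by (rule regular_elems_closed)
  have "s \<otimes> (x \<ominus> y) = \<zero>"
    using s assms(2-4) by (simp add: minus_eq r_distr r_minus r_neg)
  then have "x \<ominus> y = \<zero>" using regular_elemsD[OF assms(1)] assms(2,3) by blast
  then have "x \<oplus> \<ominus> y = \<zero>" by (simp add: minus_eq)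
  then show ?thesis using assms(2,3) sum_zero_eq_neg[of x "\<ominus> y"] by simp
qed

lemma frac_rel_equiv: "equiv (carrier R \<times> regular_elems R) (frac_rel R)"
proof (rule equivI)
  show "frac_rel R \<subseteq> (carrier R \<times> regular_elems R) \<times> (carrier R \<times> regular_elems R)"
    by (auto simp: frac_rel_def)
  show "refl_on (carrier R \<times> regular_elems R) (frac_rel R)"
    by (auto simp: refl_on_def frac_rel_def)
  show "sym (frac_rel R)" by (auto simp: sym_def frac_rel_def)
  show "trans (frac_rel R)"
  proof (rule transI)
    fix p q r assume pq: "(p, q) \<in> frac_rel R" and qr: "(q, r) \<in> frac_rel R"
    obtain x s where p: "p = (x, s)" by (cases p)
    obtain y u where q: "q = (y, u)" by (cases q)
    obtain z v where r: "r = (z, v)" by (cases r)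
    have c: "x \<in> carrier R" "y \<in> carrier R" "z \<in> carrier R"
      "s \<in> regular_elems R" "u \<in> regular_elems R" "v \<in> regular_elems R"
      and h: "x \<otimes> u = y \<otimes> s" "y \<otimes> v = z \<otimes> u"
      using pq qr unfolding p q r by (simp_all add: frac_rel_def)
    have k: "s \<in> carrier R" "u \<in> carrier R" "v \<in> carrier R"
      using c(4-6) by (simp_all add: regular_elems_closed)
    have "u \<otimes> (x \<otimes> v) = (x \<otimes> u) \<otimes> v" using c k by (simp add: m_ac)
    also have "\<dots> = (y \<otimes> v) \<otimes> s" unfolding h(1) using c(1-3) k by (simp add: m_ac)
    also have "\<dots> = u \<otimes> (z \<otimes> s)" unfolding h(2) using c(1-3) k by (simp add: m_ac)
    finally have "u \<otimes> (x \<otimes> v) = u \<otimes> (z \<otimes> s)" .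
    then have "x \<otimes> v = z \<otimes> s"
      by (rule regular_elems_cancel[OF c(5), rotated 2]) (use c(1-3) k in simp_all)
    then show "(p, r) \<in> frac_rel R" using c unfolding p r by (simp add: frac_rel_def)
  qed
qed

lemma frac_of_eq_iff:
  assumes "x \<in> carrier R" "s \<in> regular_elems R" "y \<in> carrier R" "u \<in> regular_elems R"
  shows "frac_of R x s = frac_of R y u \<longleftrightarrow> x \<otimes> u = y \<otimes> s"
  unfolding frac_of_def using eq_equiv_class_iff[OF frac_rel_equiv, of "(x, s)" "(y, u)"] assms
  by (auto simp: frac_rel_def)

lemma total_frac_carrier:
  "carrier (total_frac R) = {frac_of R x s | x s. x \<in> carrier R \<and> s \<in> regular_elems R}"
  by (auto simp: total_frac_def quotient_def frac_of_def)

lemma total_frac_mult: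
  assumes "x \<in> carrier R" "s \<in> regular_elems R" "y \<in> carrier R" "u \<in> regular_elems R"
  shows "frac_of R x s \<otimes>\<^bsub>total_frac R\<^esub> frac_of R y u = frac_of R (x \<otimes> y) (s \<otimes> u)"
proof -
  have congr: "congruent2 (frac_rel R) (frac_rel R)
    (\<lambda>p q. frac_of R (fst p \<otimes> fst q) (snd p \<otimes> snd q))"
  proof (rule congruent2I[OF frac_rel_equiv frac_rel_equiv]; clarsimp)
    fix x s y u z v
    assume h: "((y, u), (z, v)) \<in> frac_rel R" and x: "x \<in> carrier R" "s \<in> regular_elems R"
    then have c: "y \<in> carrier R" "z \<in> carrier R" "u \<in> regular_elems R" "v \<in> regular_elems R"
      "y \<otimes> v = z \<otimes> u" by (auto simp: frac_rel_def)
    then have k: "u \<in> carrier R" "v \<in> carrier R" "s \<in> carrier R"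
      using x(2) c(3,4) by (simp_all add: regular_elems_closed)
    have "(x \<otimes> y) \<otimes> (s \<otimes> v) = (x \<otimes> s) \<otimes> (y \<otimes> v)" using x c(1-4) k by (simp add: m_ac)
    also have "\<dots> = (x \<otimes> z) \<otimes> (s \<otimes> u)" unfolding c(5) using x c(1-4) k by (simp add: m_ac)
    finally have e: "(x \<otimes> y) \<otimes> (s \<otimes> v) = (x \<otimes> z) \<otimes> (s \<otimes> u)" .
    then show "frac_of R (x \<otimes> y) (s \<otimes> u) = frac_of R (x \<otimes> z) (s \<otimes> v)"
      using x c(1-4) k by (simp add: frac_of_eq_iff regular_elems_mult)
    moreover have "y \<otimes> x = x \<otimes> y" "z \<otimes> x = x \<otimes> z" "u \<otimes> s = s \<otimes> u" "v \<otimes> s = s \<otimes> v"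
      using x c(1-4) k by (simp_all add: m_comm)
    ultimately show "frac_of R (y \<otimes> x) (u \<otimes> s) = frac_of R (z \<otimes> x) (v \<otimes> s)"
      by simp
  qed
  have "(\<Union>p \<in> frac_of R x s. \<Union>q \<in> frac_of R y u. frac_of R (fst p \<otimes> fst q) (snd p \<otimes> snd q)) =
      (\<lambda>p q. frac_of R (fst p \<otimes> fst q) (snd p \<otimes> snd q)) (x, s) (y, u)"
    unfolding frac_of_def[of R x s] frac_of_def[of R y u]
    by (rule UN_equiv_class2[OF frac_rel_equiv frac_rel_equiv congr]) (use assms in auto)
  then show ?thesis by (simp add: total_frac_def)
qed

lemma total_frac_add:
  assumes "x \<in> carrier R" "s \<in> regular_elems R" "y \<in> carrier R" "u \<in> regular_elems R"
  shows "frac_of R x s \<oplus>\<^bsub>total_frac R\<^esub> frac_of R y u =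
    frac_of R ((x \<otimes> u) \<oplus> (y \<otimes> s)) (s \<otimes> u)"
proof -
  have congr: "congruent2 (frac_rel R) (frac_rel R)
    (\<lambda>p q. frac_of R ((fst p \<otimes> snd q) \<oplus> (fst q \<otimes> snd p))
      (snd p \<otimes> snd q))"
  proof (rule congruent2I[OF frac_rel_equiv frac_rel_equiv]; clarsimp)
    fix x s y u z v
    assume h: "((y, u), (z, v)) \<in> frac_rel R" and x: "x \<in> carrier R" "s \<in> regular_elems R"
    then have c: "y \<in> carrier R" "z \<in> carrier R" "u \<in> regular_elems R" "v \<in> regular_elems R"
      "y \<otimes> v = z \<otimes> u" by (auto simp: frac_rel_def)
    then have k: "u \<in> carrier R" "v \<in> carrier R" "s \<in> carrier R"
      using x(2) c(3,4) by (simp_all add: regular_elems_closed)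
    have "((x \<otimes> u) \<oplus> (y \<otimes> s)) \<otimes> (s \<otimes> v) = (x \<otimes> u \<otimes> (s \<otimes> v)) \<oplus> (s \<otimes> s) \<otimes> (y \<otimes> v)"
      using x c(1-4) k by (simp add: m_ac l_distr r_distr)
    also have "\<dots> = ((x \<otimes> v) \<oplus> (z \<otimes> s)) \<otimes> (s \<otimes> u)"
      unfolding c(5) using x c(1-4) k by (simp add: m_ac l_distr r_distr)
    finally have e: "((x \<otimes> u) \<oplus> (y \<otimes> s)) \<otimes> (s \<otimes> v) = ((x \<otimes> v) \<oplus> (z \<otimes> s)) \<otimes> (s \<otimes> u)" .
    then show "frac_of R ((x \<otimes> u) \<oplus> (y \<otimes> s)) (s \<otimes> u) =
        frac_of R ((x \<otimes> v) \<oplus> (z \<otimes> s)) (s \<otimes> v)"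
      using x c(1-4) k by (simp add: frac_of_eq_iff regular_elems_mult)
    moreover have "(y \<otimes> s) \<oplus> (x \<otimes> u) = (x \<otimes> u) \<oplus> (y \<otimes> s)"
      "(z \<otimes> s) \<oplus> (x \<otimes> v) = (x \<otimes> v) \<oplus> (z \<otimes> s)" "u \<otimes> s = s \<otimes> u" "v \<otimes> s = s \<otimes> v"
      using x c(1-4) k by (simp_all add: m_comm a_comm)
    ultimately show "frac_of R ((y \<otimes> s) \<oplus> (x \<otimes> u)) (u \<otimes> s) =
        frac_of R ((z \<otimes> s) \<oplus> (x \<otimes> v)) (v \<otimes> s)"
      by simp
  qed
  have "(\<Union>p \<in> frac_of R x s. \<Union>q \<in> frac_of R y u. frac_of R ((fst p \<otimes> snd q) \<oplus> (fst q \<otimes> snd p)) (snd p \<otimes> snd q)) =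
      (\<lambda>p q. frac_of R ((fst p \<otimes> snd q) \<oplus> (fst q \<otimes> snd p)) (snd p \<otimes> snd q)) (x, s) (y, u)"
    unfolding frac_of_def[of R x s] frac_of_def[of R y u]
    by (rule UN_equiv_class2[OF frac_rel_equiv frac_rel_equiv congr]) (use assms in auto)
  then show ?thesis by (simp add: total_frac_def)
qed

lemma total_frac_one: "\<one>\<^bsub>total_frac R\<^esub> = frac_of R \<one> \<one>"
  and total_frac_zero: "\<zero>\<^bsub>total_frac R\<^esub> = frac_of R \<zero> \<one>"
  by (simp_all add: total_frac_def)

lemma total_frac_cring: "cring (total_frac R)"
proof (rule cringI)
  let ?Q = "total_frac R"
  note frac_simps = total_frac_mult total_frac_add total_frac_one total_frac_zero
    frac_of_eq_iff regular_elems_mult regular_elems_one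
  have frac_cases: "\<exists>x s. V = frac_of R x s \<and> x \<in> carrier R \<and> s \<in> carrier R \<and> s \<in> regular_elems R"
    if "V \<in> carrier ?Q" for V
    using that regular_elems_closed by (auto simp: total_frac_carrier)
  have frac_closed: "frac_of R x s \<in> carrier ?Q" if "x \<in> carrier R" "s \<in> regular_elems R" for x s
    using that by (auto simp: total_frac_carrier)
  have add_closed: "V \<oplus>\<^bsub>?Q\<^esub> W \<in> carrier ?Q" and mult_closed: "V \<otimes>\<^bsub>?Q\<^esub> W \<in> carrier ?Q"
    and add_comm: "V \<oplus>\<^bsub>?Q\<^esub> W = W \<oplus>\<^bsub>?Q\<^esub> V" and mult_comm: "V \<otimes>\<^bsub>?Q\<^esub> W = W \<otimes>\<^bsub>?Q\<^esub> V"
    if V: "V \<in> carrier ?Q" and W: "W \<in> carrier ?Q" for V W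
  proof -
    obtain x s where x: "V = frac_of R x s" "x \<in> carrier R" "s \<in> carrier R" "s \<in> regular_elems R"
      using frac_cases[OF V] by blast
    obtain y u where y: "W = frac_of R y u" "y \<in> carrier R" "u \<in> carrier R" "u \<in> regular_elems R"
      using frac_cases[OF W] by blast
    show "V \<oplus>\<^bsub>?Q\<^esub> W \<in> carrier ?Q" "V \<otimes>\<^bsub>?Q\<^esub> W \<in> carrier ?Q"
      using x y by (simp_all add: frac_simps frac_closed)
    show "V \<oplus>\<^bsub>?Q\<^esub> W = W \<oplus>\<^bsub>?Q\<^esub> V" "V \<otimes>\<^bsub>?Q\<^esub> W = W \<otimes>\<^bsub>?Q\<^esub> V"
      using x y by (simp_all add: frac_simps m_comm a_comm)
  qed
  have add_assoc: "V \<oplus>\<^bsub>?Q\<^esub> W \<oplus>\<^bsub>?Q\<^esub> Z = V \<oplus>\<^bsub>?Q\<^esub> (W \<oplus>\<^bsub>?Q\<^esub> Z)"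
    and mult_assoc: "V \<otimes>\<^bsub>?Q\<^esub> W \<otimes>\<^bsub>?Q\<^esub> Z = V \<otimes>\<^bsub>?Q\<^esub> (W \<otimes>\<^bsub>?Q\<^esub> Z)"
    and distr: "(V \<oplus>\<^bsub>?Q\<^esub> W) \<otimes>\<^bsub>?Q\<^esub> Z = V \<otimes>\<^bsub>?Q\<^esub> Z \<oplus>\<^bsub>?Q\<^esub> W \<otimes>\<^bsub>?Q\<^esub> Z"
    if V: "V \<in> carrier ?Q" and W: "W \<in> carrier ?Q" and Z: "Z \<in> carrier ?Q" for V W Z
  proof -
    obtain x s where x: "V = frac_of R x s" "x \<in> carrier R" "s \<in> carrier R" "s \<in> regular_elems R"
      using frac_cases[OF V] by blast
    obtain y u where y: "W = frac_of R y u" "y \<in> carrier R" "u \<in> carrier R" "u \<in> regular_elems R"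
      using frac_cases[OF W] by blast
    obtain z v where z: "Z = frac_of R z v" "z \<in> carrier R" "v \<in> carrier R" "v \<in> regular_elems R"
      using frac_cases[OF Z] by blast
    have "x \<otimes> u \<oplus> y \<otimes> s \<in> carrier R" using x y by simp
    have "(x \<otimes> u \<oplus> y \<otimes> s) \<otimes> v \<oplus> z \<otimes> (s \<otimes> u) = x \<otimes> (u \<otimes> v) \<oplus> (y \<otimes> v \<oplus> z \<otimes> u) \<otimes> s"
      using x(2,3) y(2,3) z(2,3) by (simp add: l_distr r_distr m_ac a_assoc)
    then show "V \<oplus>\<^bsub>?Q\<^esub> W \<oplus>\<^bsub>?Q\<^esub> Z = V \<oplus>\<^bsub>?Q\<^esub> (W \<oplus>\<^bsub>?Q\<^esub> Z)"
      using x y z by (simp add: total_frac_add regular_elems_mult m_assoc)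
    show "V \<otimes>\<^bsub>?Q\<^esub> W \<otimes>\<^bsub>?Q\<^esub> Z = V \<otimes>\<^bsub>?Q\<^esub> (W \<otimes>\<^bsub>?Q\<^esub> Z)"
      using x y z by (simp add: total_frac_mult regular_elems_mult m_assoc)
    have "((x \<otimes> u \<oplus> y \<otimes> s) \<otimes> z) \<otimes> ((s \<otimes> v) \<otimes> (u \<otimes> v)) =
        ((x \<otimes> z) \<otimes> (u \<otimes> v) \<oplus> (y \<otimes> z) \<otimes> (s \<otimes> v)) \<otimes> ((s \<otimes> u) \<otimes> v)"
      using x(2,3) y(2,3) z(2,3) by (simp add: l_distr r_distr m_ac)
    then show "(V \<oplus>\<^bsub>?Q\<^esub> W) \<otimes>\<^bsub>?Q\<^esub> Z = V \<otimes>\<^bsub>?Q\<^esub> Z \<oplus>\<^bsub>?Q\<^esub> W \<otimes>\<^bsub>?Q\<^esub> Z"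
      using x y z by (simp add: frac_simps)
  qed
  have zero: "\<zero>\<^bsub>?Q\<^esub> \<in> carrier ?Q" and one: "\<one>\<^bsub>?Q\<^esub> \<in> carrier ?Q"
    by (simp_all add: total_frac_zero total_frac_one frac_closed regular_elems_one)
  have add_zero: "\<zero>\<^bsub>?Q\<^esub> \<oplus>\<^bsub>?Q\<^esub> V = V" and mult_one: "\<one>\<^bsub>?Q\<^esub> \<otimes>\<^bsub>?Q\<^esub> V = V"
    and add_inv: "\<exists>W \<in> carrier ?Q. W \<oplus>\<^bsub>?Q\<^esub> V = \<zero>\<^bsub>?Q\<^esub>"
    if V: "V \<in> carrier ?Q" for V
  proof -
    obtain x s where x: "V = frac_of R x s" "x \<in> carrier R" "s \<in> carrier R" "s \<in> regular_elems R"
      using frac_cases[OF V] by blast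
    then show "\<zero>\<^bsub>?Q\<^esub> \<oplus>\<^bsub>?Q\<^esub> V = V" "\<one>\<^bsub>?Q\<^esub> \<otimes>\<^bsub>?Q\<^esub> V = V" by (simp_all add: frac_simps)
    have "frac_of R (\<ominus> x) s \<oplus>\<^bsub>?Q\<^esub> V = \<zero>\<^bsub>?Q\<^esub>"
      using x by (simp add: frac_simps l_minus l_neg)
    then show "\<exists>W \<in> carrier ?Q. W \<oplus>\<^bsub>?Q\<^esub> V = \<zero>\<^bsub>?Q\<^esub>"
      using frac_closed[of "\<ominus> x" s] x by auto
  qed
  show "abelian_group ?Q"
    by (rule abelian_groupI) (fact add_closed zero add_assoc add_comm add_zero add_inv)+
  show "comm_monoid ?Q"
    by (rule comm_monoidI) (fact mult_closed one mult_assoc mult_one mult_comm)+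
  show "(V \<oplus>\<^bsub>?Q\<^esub> W) \<otimes>\<^bsub>?Q\<^esub> Z = V \<otimes>\<^bsub>?Q\<^esub> Z \<oplus>\<^bsub>?Q\<^esub> W \<otimes>\<^bsub>?Q\<^esub> Z"
    if "V \<in> carrier ?Q" "W \<in> carrier ?Q" "Z \<in> carrier ?Q" for V W Z
    using that by (rule distr)
qed

lemma to_total_frac_hom: "to_total_frac R \<in> ring_hom R (total_frac R)"
proof (rule ring_hom_memI)
  fix x assume "x \<in> carrier R"
  then show "to_total_frac R x \<in> carrier (total_frac R)"
    unfolding to_total_frac_def total_frac_carrier using regular_elems_one by blast
qed (simp_all add: to_total_frac_def total_frac_mult total_frac_add total_frac_one regular_elems_one)

lemma to_total_frac_inj: "inj_on (to_total_frac R) (carrier R)"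
  by (auto simp: inj_on_def to_total_frac_def frac_of_eq_iff regular_elems_one)

end

locale rees_setup = cring R for R (structure) +
  fixes I a b
  assumes I: "ideal I R" and a: "a \<in> carrier R" and b: "b \<in> carrier R"
begin

sublocale UP: UP_cring R "UP R" by unfold_locales

abbreviation "Rees \<equiv> rees_algebra R I"
abbreviation "J \<equiv> quad_ideal R a b \<inter> carrier Rees"

lemma power_ideal: "ideal (I [^]\<^bsub>ideals_set R\<^esub> (n::nat)) R"
proof -
  interpret M: comm_monoid "ideals_set R" by (rule ideals_set_is_comm_monoid)
  have "I [^]\<^bsub>ideals_set R\<^esub> n \<in> carrier (ideals_set R)"
    using I by (intro M.nat_pow_closed) (simp add: ideals_set_def)
  then show ?thesis by (simp add: ideals_set_def)
qed

lemma power_mult: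
  assumes "x \<in> I [^]\<^bsub>ideals_set R\<^esub> (m::nat)" "y \<in> I [^]\<^bsub>ideals_set R\<^esub> (n::nat)"
  shows "x \<otimes> y \<in> I [^]\<^bsub>ideals_set R\<^esub> (m + n)"
proof -
  interpret M: comm_monoid "ideals_set R" by (rule ideals_set_is_comm_monoid)
  have "I [^]\<^bsub>ideals_set R\<^esub> (m + n) = ideal_prod R (I [^]\<^bsub>ideals_set R\<^esub> m) (I [^]\<^bsub>ideals_set R\<^esub> n)"
    using M.nat_pow_mult[of I m n] I by (simp add: ideals_set_def)
  then show ?thesis using ideal_prod.prod[OF assms] by simp
qed

lemma ideal_finsum:
  assumes "ideal K R" "finite A" "\<And>i. i \<in> A \<Longrightarrow> f i \<in> K"
  shows "(\<Oplus>i\<in>A. f i) \<in> K"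
  using assms(2,3)
proof (induction A rule: finite_induct)
  case empty
  then show ?case using assms(1) by (simp add: additive_subgroup.zero_closed ideal_def)
next
  case (insert i A)
  have "f \<in> A \<rightarrow> carrier R" "f i \<in> carrier R"
    using insert ideal.Icarr[OF assms(1)] by auto
  with insert show ?case
    using additive_subgroup.a_closed[OF ideal.axioms(1)[OF assms(1)]] by simp
qed

lemma rees_carrier_iff: "p \<in> carrier Rees \<longleftrightarrow>
    p \<in> carrier (UP R) \<and> (\<forall>n. coeff (UP R) p n \<in> I [^]\<^bsub>ideals_set R\<^esub> n)"
  by (simp add: rees_algebra_def)

lemma rees_subring: "subring (carrier Rees) (UP R)"
proof (rule UP.subringI)
  note ag = ideal.axioms(1)[OF power_ideal]
  show "carrier Rees \<subseteq> carrier (UP R)" by (auto simp: rees_carrier_iff)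
  show "\<one>\<^bsub>UP R\<^esub> \<in> carrier Rees"
    using additive_subgroup.zero_closed[OF ag] by (auto simp: rees_carrier_iff ideals_set_def)
  fix p assume p: "p \<in> carrier Rees"
  then show "\<ominus>\<^bsub>UP R\<^esub> p \<in> carrier Rees"
    using additive_subgroup.a_inv_closed[OF ag] ring_axioms
    by (auto simp: rees_carrier_iff abelian_group_def)
  fix q assume q: "q \<in> carrier Rees"
  show "p \<oplus>\<^bsub>UP R\<^esub> q \<in> carrier Rees"
    using additive_subgroup.a_closed[OF ag] p q by (auto simp: rees_carrier_iff)
  have "coeff (UP R) (p \<otimes>\<^bsub>UP R\<^esub> q) n \<in> I [^]\<^bsub>ideals_set R\<^esub> n" for n
  proof -
    have prods: "coeff (UP R) p i \<otimes> coeff (UP R) q (n - i) \<in> I [^]\<^bsub>ideals_set R\<^esub> n" if "i \<in> {..n}" for i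
      using power_mult[of _ i _ "n - i"] p q that by (auto simp: rees_carrier_iff)
    show ?thesis
      using p q ideal_finsum[OF power_ideal finite_atMost prods] by (simp add: rees_carrier_iff)
  qed
  then show "p \<otimes>\<^bsub>UP R\<^esub> q \<in> carrier Rees" using p q by (auto simp: rees_carrier_iff)
qed

lemma rees_eq: "Rees = (UP R)\<lparr>carrier := carrier Rees\<rparr>"
  by (simp add: rees_algebra_def)

lemma rees_cring: "cring Rees"
  using UP.subcring_iff[of "carrier Rees"] UP.subcringI'[OF rees_subring]
    subringE(1)[OF rees_subring] rees_eq by simp

lemma quad_ideal_ideal: "ideal (quad_ideal R a b) (UP R)"
  unfolding quad_ideal_def
  by (rule UP.cgenideal_ideal) (use a b in \<open>simp add: quad_poly_def\<close>)

lemma rees_add: "p \<oplus>\<^bsub>Rees\<^esub> q = p \<oplus>\<^bsub>UP R\<^esub> q"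
  and rees_mult: "p \<otimes>\<^bsub>Rees\<^esub> q = p \<otimes>\<^bsub>UP R\<^esub> q"
  and rees_one: "\<one>\<^bsub>Rees\<^esub> = \<one>\<^bsub>UP R\<^esub>"
  and rees_zero: "\<zero>\<^bsub>Rees\<^esub> = \<zero>\<^bsub>UP R\<^esub>"
  by (simp_all add: rees_algebra_def)

lemma rees_inv: "p \<in> carrier Rees \<Longrightarrow> \<ominus>\<^bsub>Rees\<^esub> p = \<ominus>\<^bsub>UP R\<^esub> p"
proof -
  assume p: "p \<in> carrier Rees"
  interpret C: cring Rees by (rule rees_cring)
  have "\<ominus>\<^bsub>UP R\<^esub> p \<in> carrier Rees" "p \<in> carrier (UP R)"
    using p subringE(5,1)[OF rees_subring] by auto
  then show ?thesis
    using p C.minus_equality[of "\<ominus>\<^bsub>UP R\<^esub> p" p] UP.l_neg[of p] by (simp add: rees_add rees_zero)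
qed

lemma J_ideal: "ideal J Rees"
proof -
  interpret C: cring Rees by (rule rees_cring)
  interpret Q: ideal "quad_ideal R a b" "UP R" by (rule quad_ideal_ideal)
  note sub = subringE(1)[OF rees_subring]
  show ?thesis
  proof (rule idealI[OF C.ring_axioms])
    show "subgroup J (add_monoid Rees)"
    proof (rule C.add.subgroupI)
      show "J \<noteq> {}" using Q.zero_closed C.zero_closed rees_zero by (metis IntI empty_iff)
      show "\<ominus>\<^bsub>Rees\<^esub> p \<in> J" if "p \<in> J" for p
        using that C.a_inv_closed[of p] by (auto simp: rees_inv)
      show "p \<oplus>\<^bsub>Rees\<^esub> q \<in> J" if "p \<in> J" "q \<in> J" for p q
        using that C.a_closed[of p q] by (auto simp: rees_add)
    qed auto
    fix p q assume h: "p \<in> J" "q \<in> carrier Rees"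
    then show "q \<otimes>\<^bsub>Rees\<^esub> p \<in> J" "p \<otimes>\<^bsub>Rees\<^esub> q \<in> J"
      using sub C.m_closed[of p q] C.m_closed[of q p] Q.I_l_closed[of p q] Q.I_r_closed[of p q]
      by (auto simp: rees_mult)
  qed
qed

lemma rees_incl_coset:
  assumes p: "p \<in> carrier Rees"
  shows "rees_incl R a b (J +>\<^bsub>Rees\<^esub> p) = quad_ideal R a b +>\<^bsub>UP R\<^esub> p"
proof -
  interpret Q: ideal "quad_ideal R a b" "UP R" by (rule quad_ideal_ideal)
  interpret J: ideal J Rees by (rule J_ideal)
  have pc: "p \<in> carrier (UP R)" using p subringE(1)[OF rees_subring] by auto
  show ?thesis
  proof
    show "rees_incl R a b (J +>\<^bsub>Rees\<^esub> p) \<subseteq> quad_ideal R a b +>\<^bsub>UP R\<^esub> p"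
    proof
      fix q assume "q \<in> rees_incl R a b (J +>\<^bsub>Rees\<^esub> p)"
      then obtain f g where fg: "f \<in> quad_ideal R a b" "g \<in> J" "q = f \<oplus>\<^bsub>UP R\<^esub> (g \<oplus>\<^bsub>UP R\<^esub> p)"
        by (auto simp: rees_incl_def set_add_def' a_r_coset_def' rees_add)
      then have "q = (f \<oplus>\<^bsub>UP R\<^esub> g) \<oplus>\<^bsub>UP R\<^esub> p" "f \<oplus>\<^bsub>UP R\<^esub> g \<in> quad_ideal R a b"
        using pc Q.Icarr by (auto simp: UP.a_assoc)
      then show "q \<in> quad_ideal R a b +>\<^bsub>UP R\<^esub> p" by (auto simp: a_r_coset_def')
    qed
    show "quad_ideal R a b +>\<^bsub>UP R\<^esub> p \<subseteq> rees_incl R a b (J +>\<^bsub>Rees\<^esub> p)"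
    proof
      fix q assume "q \<in> quad_ideal R a b +>\<^bsub>UP R\<^esub> p"
      then obtain f where f: "f \<in> quad_ideal R a b" "q = f \<oplus>\<^bsub>UP R\<^esub> p"
        by (auto simp: a_r_coset_def')
      have "p \<in> J +>\<^bsub>Rees\<^esub> p" by (rule J.a_rcos_self[OF p])
      then show "q \<in> rees_incl R a b (J +>\<^bsub>Rees\<^esub> p)"
        using f by (auto simp: rees_incl_def set_add_def')
    qed
  qed
qed

lemma rees_quot_carrier: "carrier (rees_quot R I a b) = {J +>\<^bsub>Rees\<^esub> p | p. p \<in> carrier Rees}"
  by (auto simp: rees_quot_def FactRing_def A_RCOSETS_def')

lemma rees_quot_cring: "cring (rees_quot R I a b)"
  unfolding rees_quot_def by (rule ideal.quotient_is_cring[OF J_ideal rees_cring])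

lemma quad_ext_cring: "cring (quad_ext R a b)"
  unfolding quad_ext_def by (rule ideal.quotient_is_cring[OF quad_ideal_ideal UP.is_cring])

lemma rees_incl_hom: "rees_incl R a b \<in> ring_hom (rees_quot R I a b) (quad_ext R a b)"
proof -
  interpret C: cring Rees by (rule rees_cring)
  note J_hom = ideal.rcos_ring_hom[OF J_ideal, folded rees_quot_def]
  note Q_hom = ideal.rcos_ring_hom[OF quad_ideal_ideal, folded quad_ext_def]
  note sub = subsetD[OF subringE(1)[OF rees_subring]]
  show ?thesis
  proof (rule ring_hom_memI)
    fix x assume "x \<in> carrier (rees_quot R I a b)"
    then obtain p where p: "p \<in> carrier Rees" "x = J +>\<^bsub>Rees\<^esub> p" by (auto simp: rees_quot_carrier)
    then show "rees_incl R a b x \<in> carrier (quad_ext R a b)"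
      using ring_hom_closed[OF Q_hom sub] by (simp add: rees_incl_coset)
    fix y assume "y \<in> carrier (rees_quot R I a b)"
    then obtain q where q: "q \<in> carrier Rees" "y = J +>\<^bsub>Rees\<^esub> q" by (auto simp: rees_quot_carrier)
    show "rees_incl R a b (x \<otimes>\<^bsub>rees_quot R I a b\<^esub> y) =
        rees_incl R a b x \<otimes>\<^bsub>quad_ext R a b\<^esub> rees_incl R a b y"
      using p q ring_hom_mult[OF J_hom p(1) q(1)] ring_hom_mult[OF Q_hom sub[OF p(1)] sub[OF q(1)]]
        C.m_closed[of p q] by (metis rees_incl_coset rees_mult)
    show "rees_incl R a b (x \<oplus>\<^bsub>rees_quot R I a b\<^esub> y) =
        rees_incl R a b x \<oplus>\<^bsub>quad_ext R a b\<^esub> rees_incl R a b y"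
      using p q ring_hom_add[OF J_hom p(1) q(1)] ring_hom_add[OF Q_hom sub[OF p(1)] sub[OF q(1)]]
        C.a_closed[of p q] by (metis rees_incl_coset rees_add)
  next
    show "rees_incl R a b \<one>\<^bsub>rees_quot R I a b\<^esub> = \<one>\<^bsub>quad_ext R a b\<^esub>"
      using ring_hom_one[OF J_hom] ring_hom_one[OF Q_hom] C.one_closed
      by (metis rees_incl_coset rees_one)
  qed
qed

lemma rees_incl_inj: "inj_on (rees_incl R a b) (carrier (rees_quot R I a b))"
proof (rule inj_onI)
  interpret C: cring Rees by (rule rees_cring)
  interpret Q: ideal "quad_ideal R a b" "UP R" by (rule quad_ideal_ideal)
  interpret J: ideal J Rees by (rule J_ideal)
  note sub = subsetD[OF subringE(1)[OF rees_subring]]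
  fix x y
  assume "x \<in> carrier (rees_quot R I a b)" "y \<in> carrier (rees_quot R I a b)"
    and e: "rees_incl R a b x = rees_incl R a b y"
  then obtain p q where p: "p \<in> carrier Rees" "x = J +>\<^bsub>Rees\<^esub> p"
    and q: "q \<in> carrier Rees" "y = J +>\<^bsub>Rees\<^esub> q" by (auto simp: rees_quot_carrier)
  have "p \<in> quad_ideal R a b +>\<^bsub>UP R\<^esub> q"
    using e p q Q.a_rcos_self[OF sub[OF p(1)]] by (simp add: rees_incl_coset)
  then obtain f where f: "f \<in> quad_ideal R a b" "p = f \<oplus>\<^bsub>UP R\<^esub> q"
    by (auto simp: a_r_coset_def')
  then have "f = p \<oplus>\<^bsub>UP R\<^esub> \<ominus>\<^bsub>UP R\<^esub> q"
    using sub[OF q(1)] Q.Icarr[OF f(1)] by (simp add: UP.a_assoc UP.r_neg)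
  then have "f = p \<oplus>\<^bsub>Rees\<^esub> \<ominus>\<^bsub>Rees\<^esub> q" using q by (simp add: rees_add rees_inv)
  then have "f \<in> carrier Rees" using p q by simp
  then have "p \<in> J +>\<^bsub>Rees\<^esub> q" using f by (auto simp: a_r_coset_def' rees_add)
  then show "x = y" using C.a_repr_independence[OF _ q(1) J.a_subgroup] p q by metis
qed

end

end

theory Submission
  imports Defs
begin

text \<open>
  Write \<open>B = R[t] / (t\<^sup>2 + a t + b)\<close> and \<open>A = R(I)\<^bsub>a,b\<^esub>\<close>. The elements of
  \<open>B\<close> are the \<open>r + r' t\<close> with \<open>r\<close>, \<open>r'\<close> in \<open>R\<close>, and those with
  \<open>r'\<close> in \<open>I\<close> come from \<open>A\<close>. Two facts give the result.

  A regular element \<open>s\<close> of \<open>R\<close> in \<open>I\<close> stays regular in \<open>B\<close>, which is free over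
  \<open>R\<close> with basis \<open>1\<close>, \<open>t\<close> (\<open>quad_const_regular\<close>), and it multiplies \<open>B\<close>
  into \<open>A\<close> (\<open>conductor_rees_incl\<close>). Hence regular elements of \<open>A\<close> stay regular in
  \<open>B\<close>, every fraction \<open>y / u\<close> over \<open>B\<close> equals the fraction \<open>s y / s u\<close> over
  \<open>A\<close>, and the inclusion extends to an isomorphism of the total rings of fractions
  (\<open>frac_map_iso\<close>).

  An element of this common ring that is integral over \<open>A\<close> is integral over
  \<open>B\<close>. Conversely, an element integral over \<open>B\<close> is integral even over
  \<open>R\<close>, whose image lies in \<open>A\<close>: a monic equation \<open>p\<close> over \<open>B\<close> divides its
  norm, the product of \<open>p\<close> and its conjugate under \<open>t \<mapsto> - a - t\<close>, and the norm is a
  monic polynomial over \<open>R\<close> (\<open>integral_over_quadratic_descent\<close>).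
\<close>

section \<open>Coefficients and values of polynomials\<close>

lemma (in UP_ring) coeff_mult_above:
  assumes pq: "p \<in> carrier P" "q \<in> carrier P"
    and p: "\<And>k. m \<le> k \<Longrightarrow> coeff P p k = \<zero>" and q: "\<And>k. n < k \<Longrightarrow> coeff P q k = \<zero>"
    and k: "m + n \<le> k"
  shows "coeff P (p \<otimes>\<^bsub>P\<^esub> q) k = \<zero>"
proof -
  have "coeff P p i \<otimes> coeff P q (k - i) = \<zero>" for i
    using pq p[of i] q[of "k - i"] k by (cases "m \<le> i") simp_all
  then show ?thesis using pq by simp
qed

lemma (in UP_ring) coeff_mult_top:
  assumes pq: "p \<in> carrier P" "q \<in> carrier P"
    and p: "\<And>k. m < k \<Longrightarrow> coeff P p k = \<zero>" and q: "\<And>k. n < k \<Longrightarrow> coeff P q k = \<zero>"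
  shows "coeff P (p \<otimes>\<^bsub>P\<^esub> q) (m + n) = coeff P p m \<otimes> coeff P q n"
proof -
  have "coeff P p i \<otimes> coeff P q (m + n - i) =
      (if m = i then coeff P p i \<otimes> coeff P q n else \<zero>)" for i
    using pq p[of i] q[of "m + n - i"] by (cases i m rule: linorder_cases) simp_all
  then have "coeff P (p \<otimes>\<^bsub>P\<^esub> q) (m + n) =
      (\<Oplus>i \<in> {..m + n}. if m = i then coeff P p i \<otimes> coeff P q n else \<zero>)"
    using pq by simp
  also have "\<dots> = coeff P p m \<otimes> coeff P q n"
    by (rule R.finsum_singleton) (use pq in auto)
  finally show ?thesis .
qed

text \<open>Polynomials of different degrees get sums over the same range, so that their values can be
  combined term by term.\<close>

lemma (in UP_pre_univ_prop) eval_up_to: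
  assumes p: "p \<in> carrier P" and s: "s \<in> carrier S"
    and n: "\<And>k. n < k \<Longrightarrow> coeff P p k = \<zero>"
  shows "eval R S h s p = (\<Oplus>\<^bsub>S\<^esub>i \<in> {..n}. h (coeff P p i) \<otimes>\<^bsub>S\<^esub> s [^]\<^bsub>S\<^esub> i)"
proof -
  have d: "deg R p \<le> n" using n p by (rule deg_aboveI)
  show ?thesis
    unfolding eval_on_carrier[OF p]
    by (rule S.add.finprod_mono_neutral_cong_left) (use p s d in \<open>auto simp: deg_aboveD\<close>)
qed

section \<open>Integral dependence\<close>

lemma UP_coeff: "p \<in> carrier (UP A) \<Longrightarrow> coeff (UP A) p = p"
  by (simp add: UP_def)

lemma truncation_in_UP:
  assumes "ring A" "\<And>i. i \<le> n \<Longrightarrow> c i \<in> carrier A"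
  shows "(\<lambda>i. if i \<le> n then c i else \<zero>\<^bsub>A\<^esub>) \<in> carrier (UP A)"
proof -
  interpret ring A by fact
  show ?thesis using assms(2) by (auto simp: UP_def intro!: exI[of _ n])
qed

text \<open>A polynomial whose top coefficient is one need not be nonzero: over the zero ring, its
  degree is zero whatever \<open>n\<close> is. There every coefficient equals one, so the leading
  coefficient is still one.\<close>

lemma integral_overI:
  assumes "cring A" "z \<in> carrier Q" "p \<in> carrier (UP A)"
    and top: "coeff (UP A) p n = \<one>\<^bsub>A\<^esub>"
    and above: "\<And>k. n < k \<Longrightarrow> coeff (UP A) p k = \<zero>\<^bsub>A\<^esub>"
    and root: "eval A Q h z p = \<zero>\<^bsub>Q\<^esub>"
  shows "integral_over A Q h z"
proof -
  interpret A: cring A by fact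
  interpret UP_cring A "UP A" by unfold_locales
  have "coeff (UP A) p (deg A p) = \<one>\<^bsub>A\<^esub>"
  proof (cases "\<one>\<^bsub>A\<^esub> = \<zero>\<^bsub>A\<^esub>")
    case True
    then have "coeff (UP A) p (deg A p) \<in> {\<zero>\<^bsub>A\<^esub>}"
      using A.one_zeroD assms(3) coeff_closed[OF assms(3)] by metis
    then show ?thesis using True by simp
  next
    case False
    have "deg A p = n"
      using deg_aboveI[of n p] deg_belowI[of n p] above top False assms(3) by (simp add: le_antisym)
    then show ?thesis using top by simp
  qed
  then show ?thesis using assms unfolding integral_over_def by blast
qed

text \<open>Integral equations as finite sums instead of polynomials. Since the coefficients
  enter only through their images, this form makes integrality easy to carry along
  homomorphisms.\<close>

lemma integral_over_iff:
  assumes "cring A" "cring Q" "h \<in> ring_hom A Q"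
  shows "integral_over A Q h z \<longleftrightarrow> z \<in> carrier Q \<and>
    (\<exists>n c. c \<in> {..n} \<rightarrow> carrier A \<and> c n = \<one>\<^bsub>A\<^esub> \<and>
      (\<Oplus>\<^bsub>Q\<^esub>i \<in> {..n::nat}. h (c i) \<otimes>\<^bsub>Q\<^esub> z [^]\<^bsub>Q\<^esub> i) = \<zero>\<^bsub>Q\<^esub>)" (is "_ \<longleftrightarrow> _ \<and> (\<exists>n c. ?P n c)")
proof -
  interpret ring_hom_cring A Q h using assms by (rule ring_hom_cringI)
  interpret UP_pre_univ_prop A Q h "UP A" by unfold_locales
  show ?thesis
  proof (intro iffI conjI; (elim conjE)?)
    assume i: "integral_over A Q h z"
    then show z: "z \<in> carrier Q" by (simp add: integral_over_def)
    obtain p where "p \<in> carrier (UP A)" "coeff (UP A) p (deg A p) = \<one>\<^bsub>A\<^esub>"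
      "eval A Q h z p = \<zero>\<^bsub>Q\<^esub>" using i unfolding integral_over_def by blast
    then have "?P (deg A p) (coeff (UP A) p)" by (auto simp: eval_on_carrier)
    then show "\<exists>n c. ?P n c" by blast
  next
    assume z: "z \<in> carrier Q" and "\<exists>n c. ?P n c"
    then obtain n c where c: "?P n c" by blast
    let ?p = "\<lambda>i. if i \<le> n then c i else \<zero>\<^bsub>A\<^esub>"
    have p: "?p \<in> carrier (UP A)" by (rule truncation_in_UP) (use c in \<open>auto intro: R.ring_axioms\<close>)
    have "eval A Q h z ?p = (\<Oplus>\<^bsub>Q\<^esub>i \<in> {..n}. h (?p i) \<otimes>\<^bsub>Q\<^esub> z [^]\<^bsub>Q\<^esub> i)"
      using eval_up_to[OF p z, of n] by (simp add: UP_coeff[OF p])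
    also have "\<dots> = (\<Oplus>\<^bsub>Q\<^esub>i \<in> {..n}. h (c i) \<otimes>\<^bsub>Q\<^esub> z [^]\<^bsub>Q\<^esub> i)"
      by (rule S.finsum_cong') (use c z in auto)
    finally have "eval A Q h z ?p = \<zero>\<^bsub>Q\<^esub>" using c by simp
    then show "integral_over A Q h z"
      using c z p by (intro integral_overI[of A z Q ?p n h]) (auto simp: UP_coeff[OF p] intro: assms)
  qed
qed

lemma integral_over_cong:
  assumes "cring A" "cring Q" "h \<in> ring_hom A Q" and eq: "\<And>x. x \<in> carrier A \<Longrightarrow> h' x = h x"
  shows "integral_over A Q h' z \<longleftrightarrow> integral_over A Q h z"
proof -
  interpret ring_hom_cring A Q h using assms(1-3) by (rule ring_hom_cringI)
  interpret UP_pre_univ_prop A Q h "UP A" by unfold_locales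
  have "eval A Q h' z p = eval A Q h z p" if "z \<in> carrier Q" "p \<in> carrier (UP A)" for p
    unfolding eval_on_carrier[OF that(2)]
    by (rule S.finsum_cong') (use that eq in auto)
  then show ?thesis unfolding integral_over_def by auto
qed

lemma integral_over_base_hom:
  assumes "cring R" "cring A" "cring Q" "k \<in> ring_hom R A" "h \<in> ring_hom A Q"
    and z: "integral_over R Q (h \<circ> k) z"
  shows "integral_over A Q h z"
proof -
  have hk: "h \<circ> k \<in> ring_hom R Q" using assms(4,5) by (rule ring_hom_trans)
  obtain n c where "c \<in> {..n::nat} \<rightarrow> carrier R" "c n = \<one>\<^bsub>R\<^esub>"
    "(\<Oplus>\<^bsub>Q\<^esub>i \<in> {..n}. (h \<circ> k) (c i) \<otimes>\<^bsub>Q\<^esub> z [^]\<^bsub>Q\<^esub> i) = \<zero>\<^bsub>Q\<^esub>"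
    using z unfolding integral_over_iff[OF assms(1,3) hk] by blast
  moreover have "z \<in> carrier Q" using z by (simp add: integral_over_def)
  ultimately show ?thesis
    unfolding integral_over_iff[OF assms(2,3,5)]
    using ring_hom_closed[OF assms(4)] ring_hom_one[OF assms(4)]
    by (intro conjI exI[of _ n] exI[of _ "k \<circ> c"]) (auto simp: Pi_iff)
qed

lemma integral_over_inj_hom:
  assumes "cring A" "cring Q" "cring Q'" "h \<in> ring_hom A Q" "g \<in> ring_hom Q Q'"
    and inj: "inj_on g (carrier Q)" and z: "z \<in> carrier Q"
  shows "integral_over A Q' (g \<circ> h) (g z) \<longleftrightarrow> integral_over A Q h z"
proof -
  interpret g: ring_hom_cring Q Q' g using assms(2,3,5) by (rule ring_hom_cringI)
  interpret h: ring_hom_cring A Q h using assms(1,2,4) by (rule ring_hom_cringI)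
  have gh: "g \<circ> h \<in> ring_hom A Q'" using assms(4,5) by (rule ring_hom_trans)
  have eq: "(\<Oplus>\<^bsub>Q'\<^esub>i \<in> {..n}. (g \<circ> h) (c i) \<otimes>\<^bsub>Q'\<^esub> g z [^]\<^bsub>Q'\<^esub> i) = \<zero>\<^bsub>Q'\<^esub> \<longleftrightarrow>
      (\<Oplus>\<^bsub>Q\<^esub>i \<in> {..n}. h (c i) \<otimes>\<^bsub>Q\<^esub> z [^]\<^bsub>Q\<^esub> i) = \<zero>\<^bsub>Q\<^esub>" (is "?s' = _ \<longleftrightarrow> ?s = _")
    if c: "c \<in> {..n::nat} \<rightarrow> carrier A" for n c
  proof -
    have "g ?s = ?s'"
      using c z by (subst g.hom_finsum) (auto intro!: g.S.finsum_cong' simp: Pi_iff)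
    moreover have "?s \<in> carrier Q" using c z by (intro g.R.finsum_closed) auto
    ultimately show ?thesis using inj_onD[OF inj, of ?s "\<zero>\<^bsub>Q\<^esub>"] by auto
  qed
  show ?thesis
    unfolding integral_over_iff[OF assms(1,3) gh] integral_over_iff[OF assms(1,2,4)]
    using z by (simp add: eq cong: conj_cong del: comp_apply)
qed

section \<open>Descent of integrality along a quadratic extension\<close>

text \<open>The norm of a monic polynomial over the quadratic extension \<open>B = k(R) + k(R) t\<close> is a monic
  polynomial over \<open>R\<close>. Split a monic equation of \<open>z\<close> over \<open>B\<close> as
  \<open>p = f + g t\<close> with \<open>f\<close>, \<open>g\<close> over \<open>R\<close>, \<open>f\<close> monic of degree
  \<open>n\<close> and \<open>g\<close> of smaller degree. The product of \<open>p\<close> with its conjugate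
  \<open>f + g (-a - t)\<close> is \<open>F = f\<^sup>2 - a f g + b g\<^sup>2\<close>, which is monic of degree
  \<open>2 n\<close>. Write \<open>x\<close>, \<open>y\<close> for the values of \<open>f\<close>, \<open>g\<close> at
  \<open>z\<close>. Then \<open>x = - y t\<close>, so the value of \<open>F\<close> is
  \<open>y\<^sup>2 (t\<^sup>2 + a t + b) = 0\<close>.\<close>

lemma integral_over_quadratic_descent:
  assumes R: "cring R" and B: "cring B" and Q: "cring Q"
    and k: "k \<in> ring_hom R B" and j: "j \<in> ring_hom B Q"
    and a: "a \<in> carrier R" and b: "b \<in> carrier R" and t: "t \<in> carrier B"
    and t_root: "t \<otimes>\<^bsub>B\<^esub> t \<oplus>\<^bsub>B\<^esub> k a \<otimes>\<^bsub>B\<^esub> t \<oplus>\<^bsub>B\<^esub> k b = \<zero>\<^bsub>B\<^esub>"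
    and gen: "\<And>y. y \<in> carrier B \<Longrightarrow>
      \<exists>r \<in> carrier R. \<exists>s \<in> carrier R. y = k r \<oplus>\<^bsub>B\<^esub> k s \<otimes>\<^bsub>B\<^esub> t"
    and z: "integral_over B Q j z"
  shows "integral_over R Q (j \<circ> k) z"
proof -
  interpret j: ring_hom_cring B Q j using B Q j by (rule ring_hom_cringI)
  interpret k: ring_hom_cring R B k using R B k by (rule ring_hom_cringI)
  interpret jk: ring_hom_cring R Q "j \<circ> k"
    using R Q ring_hom_trans[OF k j] by (rule ring_hom_cringI)
  interpret UP_pre_univ_prop R Q "j \<circ> k" "UP R" by unfold_locales
  let ?P = "UP R"
  have zc: "z \<in> carrier Q" using z by (simp add: integral_over_def)
  obtain n c where c: "c \<in> {..n::nat} \<rightarrow> carrier B" "c n = \<one>\<^bsub>B\<^esub>"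
    "(\<Oplus>\<^bsub>Q\<^esub>i \<in> {..n}. j (c i) \<otimes>\<^bsub>Q\<^esub> z [^]\<^bsub>Q\<^esub> i) = \<zero>\<^bsub>Q\<^esub>"
    using z unfolding integral_over_iff[OF B Q j] by blast
  \<comment> \<open>The representation of a coefficient by \<open>r\<close> and \<open>s\<close> need not be unique, so
    the choice \<open>1 + 0 t\<close> for the top coefficient has to be imposed.\<close>
  have "\<forall>i. \<exists>r s. i \<le> n \<longrightarrow> r \<in> carrier R \<and> s \<in> carrier R \<and>
      c i = k r \<oplus>\<^bsub>B\<^esub> k s \<otimes>\<^bsub>B\<^esub> t \<and> (i = n \<longrightarrow> r = \<one>\<^bsub>R\<^esub> \<and> s = \<zero>\<^bsub>R\<^esub>)"
  proof
    fix i
    show "\<exists>r s. i \<le> n \<longrightarrow> r \<in> carrier R \<and> s \<in> carrier R \<and>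
      c i = k r \<oplus>\<^bsub>B\<^esub> k s \<otimes>\<^bsub>B\<^esub> t \<and> (i = n \<longrightarrow> r = \<one>\<^bsub>R\<^esub> \<and> s = \<zero>\<^bsub>R\<^esub>)"
    proof (cases "i < n")
      case True
      then show ?thesis using gen[of "c i"] c(1) by fastforce
    next
      case False
      have "c n = k \<one>\<^bsub>R\<^esub> \<oplus>\<^bsub>B\<^esub> k \<zero>\<^bsub>R\<^esub> \<otimes>\<^bsub>B\<^esub> t" using c(2) t by simp
      then show ?thesis using False by (metis k.R.one_closed k.R.zero_closed linorder_neqE_nat not_less)
    qed
  qed
  then obtain r s where rs: "\<And>i. i \<le> n \<Longrightarrow> r i \<in> carrier R \<and> s i \<in> carrier R \<and>
      c i = k (r i) \<oplus>\<^bsub>B\<^esub> k (s i) \<otimes>\<^bsub>B\<^esub> t" and top: "r n = \<one>\<^bsub>R\<^esub>" "s n = \<zero>\<^bsub>R\<^esub>"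
    by (metis order_refl)
  define f where "f = (\<lambda>i. if i \<le> n then r i else \<zero>\<^bsub>R\<^esub>)"
  define g where "g = (\<lambda>i. if i \<le> n then s i else \<zero>\<^bsub>R\<^esub>)"
  have f: "f \<in> carrier ?P" and g: "g \<in> carrier ?P"
    unfolding f_def g_def using rs by (auto intro!: truncation_in_UP k.R.ring_axioms)
  have cf: "coeff ?P f i = (if i \<le> n then r i else \<zero>\<^bsub>R\<^esub>)"
    and cg: "coeff ?P g i = (if i \<le> n then s i else \<zero>\<^bsub>R\<^esub>)" for i
    using UP_coeff[OF f] UP_coeff[OF g] by (simp_all add: f_def g_def)
  have f_above: "coeff ?P f i = \<zero>\<^bsub>R\<^esub>" if "n < i" for i using that by (simp add: cf)
  have g_above: "coeff ?P g i = \<zero>\<^bsub>R\<^esub>" if "n \<le> i" for i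
    using that top by (auto simp: cg)
  define F where "F = f \<otimes>\<^bsub>?P\<^esub> f \<oplus>\<^bsub>?P\<^esub> (\<ominus>\<^bsub>?P\<^esub> (a \<odot>\<^bsub>?P\<^esub> (g \<otimes>\<^bsub>?P\<^esub> f)) \<oplus>\<^bsub>?P\<^esub> b \<odot>\<^bsub>?P\<^esub> (g \<otimes>\<^bsub>?P\<^esub> g))"
  have F: "F \<in> carrier ?P" using f g a b by (simp add: F_def)
  have cF: "coeff ?P F i = coeff ?P (f \<otimes>\<^bsub>?P\<^esub> f) i" if "n + n \<le> i" for i
  proof -
    have "coeff ?P (g \<otimes>\<^bsub>?P\<^esub> f) i = \<zero>\<^bsub>R\<^esub>" "coeff ?P (g \<otimes>\<^bsub>?P\<^esub> g) i = \<zero>\<^bsub>R\<^esub>"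
      by (rule coeff_mult_above[OF g f g_above f_above that], assumption+)
        (rule coeff_mult_above[OF g g g_above _ that], simp_all add: g_above)
    then show ?thesis using f g a b by (simp add: F_def del: coeff_mult)
  qed
  let ?E = "eval R Q (j \<circ> k) z"
  let ?x = "?E f" and ?y = "?E g"
  interpret E: ring_hom_cring ?P Q ?E
    using UP_cring Q eval_ring_hom[OF zc] by (rule ring_hom_cringI)
  have xy: "?x \<in> carrier Q" "?y \<in> carrier Q" using f g by auto
  have lin: "?x \<oplus>\<^bsub>Q\<^esub> ?y \<otimes>\<^bsub>Q\<^esub> j t = \<zero>\<^bsub>Q\<^esub>"
  proof -
    have "?x = (\<Oplus>\<^bsub>Q\<^esub>i \<in> {..n}. (j \<circ> k) (r i) \<otimes>\<^bsub>Q\<^esub> z [^]\<^bsub>Q\<^esub> i)"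
      using rs zc by (subst eval_up_to[OF f zc f_above]) (auto intro!: j.S.finsum_cong' simp: cf)
    moreover have "?y \<otimes>\<^bsub>Q\<^esub> j t = (\<Oplus>\<^bsub>Q\<^esub>i \<in> {..n}. (j \<circ> k) (s i) \<otimes>\<^bsub>Q\<^esub> z [^]\<^bsub>Q\<^esub> i \<otimes>\<^bsub>Q\<^esub> j t)"
      using rs zc t by (subst eval_up_to[OF g zc g_above])
        (auto intro!: j.S.finsum_cong' simp: cg j.S.finsum_ldistr)
    ultimately have "?x \<oplus>\<^bsub>Q\<^esub> ?y \<otimes>\<^bsub>Q\<^esub> j t = (\<Oplus>\<^bsub>Q\<^esub>i \<in> {..n}. (j \<circ> k) (r i) \<otimes>\<^bsub>Q\<^esub> z [^]\<^bsub>Q\<^esub> i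
        \<oplus>\<^bsub>Q\<^esub> (j \<circ> k) (s i) \<otimes>\<^bsub>Q\<^esub> z [^]\<^bsub>Q\<^esub> i \<otimes>\<^bsub>Q\<^esub> j t)"
      using rs zc t by (simp add: j.S.finsum_addf)
    also have "\<dots> = (\<Oplus>\<^bsub>Q\<^esub>i \<in> {..n}. j (c i) \<otimes>\<^bsub>Q\<^esub> z [^]\<^bsub>Q\<^esub> i)"
      using rs zc t by (intro j.S.finsum_cong') (auto simp: j.S.l_distr j.S.r_distr j.S.m_ac)
    finally show ?thesis using c(3) by simp
  qed
  let ?T = "j t" and ?a = "j (k a)" and ?b = "j (k b)"
  have cl: "?T \<in> carrier Q" "?a \<in> carrier Q" "?b \<in> carrier Q" using t a b by auto
  have T: "?T \<otimes>\<^bsub>Q\<^esub> ?T \<oplus>\<^bsub>Q\<^esub> ?a \<otimes>\<^bsub>Q\<^esub> ?T \<oplus>\<^bsub>Q\<^esub> ?b = \<zero>\<^bsub>Q\<^esub>"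
    using arg_cong[OF t_root, of j] t a b by simp
  have x: "?x = \<ominus>\<^bsub>Q\<^esub> (?y \<otimes>\<^bsub>Q\<^esub> ?T)" using lin xy cl by (simp add: j.S.sum_zero_eq_neg)
  have smult: "?E (u \<odot>\<^bsub>?P\<^esub> p) = j (k u) \<otimes>\<^bsub>Q\<^esub> ?E p" if "u \<in> carrier R" "p \<in> carrier ?P" for u p
    using that zc by (simp add: monom_mult_is_smult[symmetric] eval_const)
  have "?E F = ?x \<otimes>\<^bsub>Q\<^esub> ?x \<oplus>\<^bsub>Q\<^esub> (\<ominus>\<^bsub>Q\<^esub> (?a \<otimes>\<^bsub>Q\<^esub> (?y \<otimes>\<^bsub>Q\<^esub> ?x)) \<oplus>\<^bsub>Q\<^esub> ?b \<otimes>\<^bsub>Q\<^esub> (?y \<otimes>\<^bsub>Q\<^esub> ?y))"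
    using f g a b by (simp add: F_def smult)
  also have "\<dots> = ?y \<otimes>\<^bsub>Q\<^esub> ?y \<otimes>\<^bsub>Q\<^esub> (?T \<otimes>\<^bsub>Q\<^esub> ?T \<oplus>\<^bsub>Q\<^esub> ?a \<otimes>\<^bsub>Q\<^esub> ?T \<oplus>\<^bsub>Q\<^esub> ?b)"
    unfolding x using xy cl by (simp add: j.S.r_distr j.S.l_minus j.S.r_minus j.S.m_ac j.S.a_ac)
  finally have "?E F = \<zero>\<^bsub>Q\<^esub>" using T xy by simp
  moreover have "coeff ?P F (n + n) = \<one>\<^bsub>R\<^esub>"
    using coeff_mult_top[OF f f f_above f_above] top by (simp add: cF cf del: coeff_mult)
  moreover have "coeff ?P F i = \<zero>\<^bsub>R\<^esub>" if "n + n < i" for i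
    using that coeff_mult_above[OF f f, of "Suc n" n i] f_above by (simp add: cF del: coeff_mult)
  ultimately show ?thesis using R zc F by (intro integral_overI[of R z Q F "n + n"])
qed

section \<open>Extensions with a regular element in the conductor\<close>

text \<open>An extension \<open>A \<subseteq> B\<close> (by way of \<open>\<phi>\<close>) whose conductor contains an element
  \<open>e\<close> that is regular in \<open>B\<close>. Every \<open>y\<close> in \<open>B\<close> is then the
  fraction \<open>e y / e\<close> of elements of \<open>A\<close>.\<close>

locale regular_conductor = A: cring A + B: cring B
  for A :: "('a, 'm) ring_scheme" and B :: "('b, 'n) ring_scheme" +
  fixes \<phi> :: "'a \<Rightarrow> 'b" and e :: 'a
  assumes hom: "\<phi> \<in> ring_hom A B" and inj: "inj_on \<phi> (carrier A)"
    and e: "e \<in> carrier A" and e_regular: "\<phi> e \<in> regular_elems B"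
    and conductor: "y \<in> carrier B \<Longrightarrow> \<phi> e \<otimes>\<^bsub>B\<^esub> y \<in> \<phi> ` carrier A"
begin

sublocale \<phi>: ring_hom_cring A B \<phi>
  using A.is_cring B.is_cring hom by (rule ring_hom_cringI)

text \<open>An injective homomorphism need not preserve regular elements; here the conductor is what helps.
  If \<open>s y = 0\<close> with \<open>y\<close> in \<open>B\<close>, then \<open>e y\<close> lies in \<open>A\<close> and is
  killed by \<open>s\<close>. So \<open>e y = 0\<close>, and \<open>y = 0\<close>.\<close>

lemma hom_regular:
  assumes "s \<in> regular_elems A"
  shows "\<phi> s \<in> regular_elems B"
proof -
  have s: "s \<in> carrier A" using assms by (rule A.regular_elems_closed)
  have "y = \<zero>\<^bsub>B\<^esub>" if y: "y \<in> carrier B" "\<phi> s \<otimes>\<^bsub>B\<^esub> y = \<zero>\<^bsub>B\<^esub>" for y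
  proof -
    obtain x where x: "x \<in> carrier A" "\<phi> e \<otimes>\<^bsub>B\<^esub> y = \<phi> x" using conductor[OF y(1)] by blast
    have "\<phi> (s \<otimes>\<^bsub>A\<^esub> x) = \<phi> e \<otimes>\<^bsub>B\<^esub> (\<phi> s \<otimes>\<^bsub>B\<^esub> y)"
      using x s y(1) e by (simp flip: x(2) add: B.m_ac)
    then have "\<phi> (s \<otimes>\<^bsub>A\<^esub> x) = \<phi> \<zero>\<^bsub>A\<^esub>" using y e by simp
    then have "s \<otimes>\<^bsub>A\<^esub> x = \<zero>\<^bsub>A\<^esub>" using inj s x by (simp only: inj_on_eq_iff A.m_closed A.zero_closed)
    then have "\<phi> e \<otimes>\<^bsub>B\<^esub> y = \<zero>\<^bsub>B\<^esub>" using A.regular_elemsD[OF assms x(1)] x(2) by simp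
    then show ?thesis using B.regular_elemsD[OF e_regular y(1)] by simp
  qed
  then show ?thesis using s unfolding regular_elems_def by simp
qed

lemma regular_if_hom_regular:
  assumes s: "s \<in> carrier A" and "\<phi> s \<in> regular_elems B"
  shows "s \<in> regular_elems A"
proof -
  have "x = \<zero>\<^bsub>A\<^esub>" if "x \<in> carrier A" "s \<otimes>\<^bsub>A\<^esub> x = \<zero>\<^bsub>A\<^esub>" for x
  proof -
    have "\<phi> s \<otimes>\<^bsub>B\<^esub> \<phi> x = \<zero>\<^bsub>B\<^esub>" using that s \<phi>.hom_mult[of s x] by simp
    then have "\<phi> x = \<phi> \<zero>\<^bsub>A\<^esub>" using B.regular_elemsD[OF assms(2)] that by simp
    then show ?thesis using inj that by (simp only: inj_on_eq_iff A.zero_closed)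
  qed
  then show ?thesis using s unfolding regular_elems_def by simp
qed

definition frac_map :: "('a \<times> 'a) set \<Rightarrow> ('b \<times> 'b) set"
  where "frac_map V = (\<Union>p \<in> V. frac_of B (\<phi> (fst p)) (\<phi> (snd p)))"

lemma frac_map_frac:
  assumes "x \<in> carrier A" "s \<in> regular_elems A"
  shows "frac_map (frac_of A x s) = frac_of B (\<phi> x) (\<phi> s)"
proof -
  have congr: "congruent (frac_rel A) (\<lambda>p. frac_of B (\<phi> (fst p)) (\<phi> (snd p)))"
  proof (rule congruentI, clarsimp)
    fix x s y u assume "((x, s), (y, u)) \<in> frac_rel A"
    then have c: "x \<in> carrier A" "y \<in> carrier A" "s \<in> regular_elems A" "u \<in> regular_elems A"
      and eq: "x \<otimes>\<^bsub>A\<^esub> u = y \<otimes>\<^bsub>A\<^esub> s"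
      by (simp_all add: frac_rel_def)
    have "\<phi> x \<otimes>\<^bsub>B\<^esub> \<phi> u = \<phi> y \<otimes>\<^bsub>B\<^esub> \<phi> s"
      using arg_cong[OF eq, of \<phi>] c by (simp add: A.regular_elems_closed)
    then show "frac_of B (\<phi> x) (\<phi> s) = frac_of B (\<phi> y) (\<phi> u)"
      using c by (simp add: B.frac_of_eq_iff hom_regular)
  qed
  show ?thesis
    using UN_equiv_class[OF A.frac_rel_equiv congr, of "(x, s)"] assms
    by (simp add: frac_map_def frac_of_def[of A])
qed

lemma frac_map_hom: "frac_map \<in> ring_hom (total_frac A) (total_frac B)"
proof (rule ring_hom_memI)
  fix V assume "V \<in> carrier (total_frac A)"
  then obtain x s where V: "V = frac_of A x s" "x \<in> carrier A" "s \<in> regular_elems A"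
    by (auto simp: A.total_frac_carrier)
  show "frac_map V \<in> carrier (total_frac B)"
    using V hom_regular by (auto simp: frac_map_frac B.total_frac_carrier)
  fix W assume "W \<in> carrier (total_frac A)"
  then obtain y u where W: "W = frac_of A y u" "y \<in> carrier A" "u \<in> regular_elems A"
    by (auto simp: A.total_frac_carrier)
  note simps = V W A.regular_elems_closed[OF V(3)] A.regular_elems_closed[OF W(3)] hom_regular
    A.total_frac_mult A.total_frac_add B.total_frac_mult B.total_frac_add frac_map_frac
    A.regular_elems_mult
  show "frac_map (V \<otimes>\<^bsub>total_frac A\<^esub> W) = frac_map V \<otimes>\<^bsub>total_frac B\<^esub> frac_map W"
    "frac_map (V \<oplus>\<^bsub>total_frac A\<^esub> W) = frac_map V \<oplus>\<^bsub>total_frac B\<^esub> frac_map W"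
    by (simp_all add: simps)
qed (simp add: A.total_frac_one B.total_frac_one frac_map_frac A.regular_elems_one)

lemma frac_map_inj: "inj_on frac_map (carrier (total_frac A))"
proof (rule inj_onI)
  fix V W assume "V \<in> carrier (total_frac A)" "W \<in> carrier (total_frac A)"
    and eq: "frac_map V = frac_map W"
  then obtain x s y u where V: "V = frac_of A x s" "x \<in> carrier A" "s \<in> regular_elems A"
    and W: "W = frac_of A y u" "y \<in> carrier A" "u \<in> regular_elems A"
    by (auto simp: A.total_frac_carrier)
  note su = A.regular_elems_closed[OF V(3)] A.regular_elems_closed[OF W(3)]
  have "\<phi> (x \<otimes>\<^bsub>A\<^esub> u) = \<phi> (y \<otimes>\<^bsub>A\<^esub> s)"
    using eq V W su by (simp add: frac_map_frac B.frac_of_eq_iff hom_regular)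
  then have "x \<otimes>\<^bsub>A\<^esub> u = y \<otimes>\<^bsub>A\<^esub> s" using inj V W su by (simp only: inj_on_eq_iff A.m_closed)
  then show "V = W" using V W by (simp add: A.frac_of_eq_iff)
qed

text \<open>The fraction \<open>y / u\<close> over \<open>B\<close> equals \<open>e y / e u\<close>, and both \<open>e y\<close> and
  \<open>e u\<close> lie in \<open>A\<close>.\<close>

lemma frac_map_surj: "frac_map ` carrier (total_frac A) = carrier (total_frac B)"
proof
  show "frac_map ` carrier (total_frac A) \<subseteq> carrier (total_frac B)"
    using ring_hom_closed[OF frac_map_hom] by blast
  show "carrier (total_frac B) \<subseteq> frac_map ` carrier (total_frac A)"
  proof
    fix W assume "W \<in> carrier (total_frac B)"
    then obtain y u where W: "W = frac_of B y u" "y \<in> carrier B" "u \<in> regular_elems B"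
      by (auto simp: B.total_frac_carrier)
    have u: "u \<in> carrier B" using W(3) by (rule B.regular_elems_closed)
    obtain x s where x: "x \<in> carrier A" "\<phi> e \<otimes>\<^bsub>B\<^esub> y = \<phi> x"
      and s: "s \<in> carrier A" "\<phi> e \<otimes>\<^bsub>B\<^esub> u = \<phi> s"
      using conductor[OF W(2)] conductor[OF u] by blast
    have s_reg: "s \<in> regular_elems A"
      using s(1) B.regular_elems_mult[OF e_regular W(3)] unfolding s(2) by (rule regular_if_hom_regular)
    have "\<phi> x \<otimes>\<^bsub>B\<^esub> u = y \<otimes>\<^bsub>B\<^esub> \<phi> s"
      unfolding x(2)[symmetric] s(2)[symmetric] using W(2) u e by (simp add: B.m_ac)
    then have "frac_map (frac_of A x s) = W"
      using x(1) s_reg W by (simp add: frac_map_frac B.frac_of_eq_iff hom_regular)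
    then show "W \<in> frac_map ` carrier (total_frac A)"
      using x(1) s_reg by (auto simp: A.total_frac_carrier)
  qed
qed

lemma frac_map_iso: "frac_map \<in> ring_iso (total_frac A) (total_frac B)"
  unfolding ring_iso_def bij_betw_def using frac_map_hom frac_map_inj frac_map_surj by simp

lemma frac_map_to_total_frac:
  "x \<in> carrier A \<Longrightarrow> frac_map (to_total_frac A x) = to_total_frac B (\<phi> x)"
  by (simp add: to_total_frac_def frac_map_frac A.regular_elems_one)

lemma integral_over_frac_map_iff:
  assumes "V \<in> carrier (total_frac A)"
  shows "integral_over A (total_frac B) (to_total_frac B \<circ> \<phi>) (frac_map V) \<longleftrightarrow>
    V \<in> integral_closure A"
proof -
  have "integral_over A (total_frac B) (to_total_frac B \<circ> \<phi>) W \<longleftrightarrow>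
      integral_over A (total_frac B) (frac_map \<circ> to_total_frac A) W" for W
    by (rule integral_over_cong[OF A.is_cring B.total_frac_cring
        ring_hom_trans[OF A.to_total_frac_hom frac_map_hom]]) (simp add: frac_map_to_total_frac)
  then show ?thesis
    using integral_over_inj_hom[OF A.is_cring A.total_frac_cring B.total_frac_cring
        A.to_total_frac_hom frac_map_hom frac_map_inj assms]
    by (simp add: integral_closure_def)
qed

text \<open>An element integral over \<open>A\<close> is integral over \<open>B\<close>. The converse goes through a base
  ring \<open>R\<close> that maps to \<open>A\<close>: the extension of \<open>R\<close> by \<open>B\<close> may have a much
  simpler form than that of \<open>A\<close>, and integrality over \<open>R\<close> implies integrality over
  \<open>A\<close>.\<close>

lemma frac_map_integral_closure:
  assumes R: "cring R" and k: "k \<in> ring_hom R A"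
    and descent: "\<And>w. w \<in> integral_closure B \<Longrightarrow>
      integral_over R (total_frac B) (to_total_frac B \<circ> \<phi> \<circ> k) w"
  shows "frac_map ` integral_closure A = integral_closure B"
proof
  note base = integral_over_base_hom[OF _ _ B.total_frac_cring]
  show "frac_map ` integral_closure A \<subseteq> integral_closure B"
  proof
    fix w assume "w \<in> frac_map ` integral_closure A"
    then obtain V where V: "V \<in> integral_closure A" "w = frac_map V" by blast
    then have "V \<in> carrier (total_frac A)" by (simp add: integral_closure_def integral_over_def)
    then have "integral_over A (total_frac B) (to_total_frac B \<circ> \<phi>) w"
      using V by (simp add: integral_over_frac_map_iff)
    then show "w \<in> integral_closure B"
      unfolding integral_closure_def
      using base[OF A.is_cring B.is_cring hom B.to_total_frac_hom] by simp
  qed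
  show "integral_closure B \<subseteq> frac_map ` integral_closure A"
  proof
    fix w assume w: "w \<in> integral_closure B"
    then have "w \<in> carrier (total_frac B)" by (simp add: integral_closure_def integral_over_def)
    then obtain V where V: "V \<in> carrier (total_frac A)" "w = frac_map V"
      using frac_map_surj by blast
    have "integral_over A (total_frac B) (to_total_frac B \<circ> \<phi>) w"
      by (rule base[OF R A.is_cring k ring_hom_trans[OF hom B.to_total_frac_hom] descent[OF w]])
    then show "w \<in> frac_map ` integral_closure A"
      using V by (simp add: integral_over_frac_map_iff)
  qed
qed

end

section \<open>The quadratic extension\<close>

context rees_setup
begin

definition quad_class :: "(nat \<Rightarrow> 'a) \<Rightarrow> (nat \<Rightarrow> 'a) set"
  where "quad_class p = quad_ideal R a b +>\<^bsub>UP R\<^esub> p"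

abbreviation "quad_const r \<equiv> quad_class (monom (UP R) r 0)"
abbreviation "quad_gen \<equiv> quad_class (monom (UP R) \<one> 1)"

lemma quad_class_hom: "quad_class \<in> ring_hom (UP R) (quad_ext R a b)"
  using ideal.rcos_ring_hom[OF quad_ideal_ideal] by (simp add: quad_class_def[abs_def] quad_ext_def)

lemma quad_class_hom_cring: "ring_hom_cring (UP R) (quad_ext R a b) quad_class"
  using UP.UP_cring quad_ext_cring quad_class_hom by (rule ring_hom_cringI)

lemma quad_class_surj: "y \<in> carrier (quad_ext R a b) \<Longrightarrow> \<exists>p \<in> carrier (UP R). y = quad_class p"
  by (auto simp: quad_ext_def FactRing_def A_RCOSETS_def' quad_class_def)

lemma quad_class_eq_zero_iff:
  assumes "p \<in> carrier (UP R)"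
  shows "quad_class p = \<zero>\<^bsub>quad_ext R a b\<^esub> \<longleftrightarrow> p \<in> quad_ideal R a b"
  using UP.a_rcos_zero[OF quad_ideal_ideal] ideal.rcos_const_imp_mem[OF quad_ideal_ideal assms]
  by (auto simp: quad_class_def quad_ext_def FactRing_def)

lemma quad_const_hom: "(\<lambda>r. quad_const r) \<in> ring_hom R (quad_ext R a b)"
  using ring_hom_trans[OF UP.const_ring_hom quad_class_hom] by (simp add: comp_def)

lemma quad_poly_closed: "quad_poly R a b \<in> carrier (UP R)"
  using a b by (simp add: quad_poly_def)

lemma quad_gen_root:
  "quad_gen \<otimes>\<^bsub>quad_ext R a b\<^esub> quad_gen \<oplus>\<^bsub>quad_ext R a b\<^esub>
    quad_const a \<otimes>\<^bsub>quad_ext R a b\<^esub> quad_gen \<oplus>\<^bsub>quad_ext R a b\<^esub> quad_const b =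
    \<zero>\<^bsub>quad_ext R a b\<^esub>"
proof -
  interpret q: ring_hom_cring "UP R" "quad_ext R a b" quad_class by (rule quad_class_hom_cring)
  have "quad_class (quad_poly R a b) = \<zero>\<^bsub>quad_ext R a b\<^esub>"
    using UP.cgenideal_self[OF quad_poly_closed]
    by (simp add: quad_class_eq_zero_iff quad_poly_closed quad_ideal_def)
  moreover have "quad_poly R a b = monom (UP R) \<one> 1 \<otimes>\<^bsub>UP R\<^esub> monom (UP R) \<one> 1 \<oplus>\<^bsub>UP R\<^esub>
      monom (UP R) a 0 \<otimes>\<^bsub>UP R\<^esub> monom (UP R) \<one> 1 \<oplus>\<^bsub>UP R\<^esub> monom (UP R) b 0"
    using a by (simp add: quad_poly_def numeral_2_eq_2 flip: UP.monom_mult)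
  ultimately show ?thesis using a b by simp
qed

text \<open>The set of the elements \<open>r + s t\<close> contains the constants and is closed under addition. It is
  closed under multiplication by \<open>t\<close> because \<open>t\<^sup>2 = - a t - b\<close>. Hence it
  contains the class of every monomial, and of every polynomial.\<close>

lemma quad_ext_basis:
  assumes "y \<in> carrier (quad_ext R a b)"
  shows "\<exists>r \<in> carrier R. \<exists>s \<in> carrier R.
    y = quad_const r \<oplus>\<^bsub>quad_ext R a b\<^esub> quad_const s \<otimes>\<^bsub>quad_ext R a b\<^esub> quad_gen"
proof -
  let ?B = "quad_ext R a b" and ?t = quad_gen
  interpret q: ring_hom_cring "UP R" ?B quad_class by (rule quad_class_hom_cring)
  interpret k: ring_hom_cring R ?B "\<lambda>r. quad_const r"
    using is_cring quad_ext_cring quad_const_hom by (rule ring_hom_cringI)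
  let ?S = "{quad_const r \<oplus>\<^bsub>?B\<^esub> quad_const s \<otimes>\<^bsub>?B\<^esub> ?t | r s. r \<in> carrier R \<and> s \<in> carrier R}"
  have t: "?t \<in> carrier ?B" by simp
  have S_const: "quad_const r \<in> ?S" if "r \<in> carrier R" for r
    using that t by (intro CollectI exI[of _ r] exI[of _ "\<zero>"]) (simp del: UP.monom_zero)
  have S_add: "x \<oplus>\<^bsub>?B\<^esub> y \<in> ?S" if "x \<in> ?S" "y \<in> ?S" for x y
  proof -
    obtain r s r' s' where "r \<in> carrier R" "s \<in> carrier R" "r' \<in> carrier R" "s' \<in> carrier R"
      "x = quad_const r \<oplus>\<^bsub>?B\<^esub> quad_const s \<otimes>\<^bsub>?B\<^esub> ?t"
      "y = quad_const r' \<oplus>\<^bsub>?B\<^esub> quad_const s' \<otimes>\<^bsub>?B\<^esub> ?t"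
      using \<open>x \<in> ?S\<close> \<open>y \<in> ?S\<close> by blast
    then show ?thesis using t
      by (intro CollectI exI[of _ "r \<oplus> r'"] exI[of _ "s \<oplus> s'"])
        (simp add: q.S.l_distr q.S.a_ac del: UP.monom_add)
  qed
  have S_gen: "x \<otimes>\<^bsub>?B\<^esub> ?t \<in> ?S" if "x \<in> ?S" for x
  proof -
    obtain r s where rs: "r \<in> carrier R" "s \<in> carrier R"
      "x = quad_const r \<oplus>\<^bsub>?B\<^esub> quad_const s \<otimes>\<^bsub>?B\<^esub> ?t"
      using \<open>x \<in> ?S\<close> by blast
    let ?a = "quad_const a" and ?b = "quad_const b"
    have "?t \<otimes>\<^bsub>?B\<^esub> ?t \<oplus>\<^bsub>?B\<^esub> (?a \<otimes>\<^bsub>?B\<^esub> ?t \<oplus>\<^bsub>?B\<^esub> ?b) = \<zero>\<^bsub>?B\<^esub>"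
      using quad_gen_root a b t k.hom_closed[OF a] k.hom_closed[OF b] by (simp add: q.S.a_assoc)
    then have tt: "?t \<otimes>\<^bsub>?B\<^esub> ?t = \<ominus>\<^bsub>?B\<^esub> (?a \<otimes>\<^bsub>?B\<^esub> ?t \<oplus>\<^bsub>?B\<^esub> ?b)"
      using t k.hom_closed[OF a] k.hom_closed[OF b] by (intro q.S.sum_zero_eq_neg) simp_all
    have "x \<otimes>\<^bsub>?B\<^esub> ?t = quad_const r \<otimes>\<^bsub>?B\<^esub> ?t \<oplus>\<^bsub>?B\<^esub> quad_const s \<otimes>\<^bsub>?B\<^esub> (?t \<otimes>\<^bsub>?B\<^esub> ?t)"
      using rs t k.hom_closed by (simp add: q.S.l_distr q.S.m_assoc)
    also have "\<dots> = quad_const (\<ominus> (s \<otimes> b)) \<oplus>\<^bsub>?B\<^esub> quad_const (r \<oplus> \<ominus> (s \<otimes> a)) \<otimes>\<^bsub>?B\<^esub> ?t"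
      unfolding tt k.hom_mult[OF rs(2) a] k.hom_mult[OF rs(2) b]
        k.hom_a_inv[OF m_closed[OF rs(2) a]] k.hom_a_inv[OF m_closed[OF rs(2) b]]
      using rs a b t
      by (simp add: q.S.l_distr q.S.r_distr q.S.minus_add q.S.l_minus q.S.r_minus q.S.m_ac q.S.a_ac
        del: UP.monom_add UP.monom_a_inv UP.monom_mult)
    finally show ?thesis using rs a b by blast
  qed
  have S_sub: "?S \<subseteq> carrier ?B" using t k.hom_closed by auto
  have S_power: "quad_class (monom (UP R) r i) \<in> ?S" if r: "r \<in> carrier R" for r i
  proof (induction i)
    case 0
    then show ?case using S_const r by blast
  next
    case (Suc i)
    have "quad_class (monom (UP R) r (Suc i)) = quad_class (monom (UP R) r i) \<otimes>\<^bsub>?B\<^esub> ?t"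
      using UP.monom_mult[OF r one_closed, of i 1] r by (simp del: UP.monom_mult flip: q.hom_mult)
    then show ?case using S_gen[OF Suc.IH] by simp
  qed
  obtain p where p: "p \<in> carrier (UP R)" "y = quad_class p" using quad_class_surj[OF assms] by blast
  have "quad_class (\<Oplus>\<^bsub>UP R\<^esub>i \<in> {..n}. monom (UP R) (coeff (UP R) p i) i) \<in> ?S" for n
  proof (induction n)
    case 0
    then show ?case using S_power[of "coeff (UP R) p 0" 0] p(1) by simp
  next
    case (Suc n)
    have "(\<Oplus>\<^bsub>UP R\<^esub>i \<in> {..Suc n}. monom (UP R) (coeff (UP R) p i) i) =
      monom (UP R) (coeff (UP R) p (Suc n)) (Suc n) \<oplus>\<^bsub>UP R\<^esub> (\<Oplus>\<^bsub>UP R\<^esub>i \<in> {..n}. monom (UP R) (coeff (UP R) p i) i)"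
      using p(1) by (intro UP.finsum_Suc) auto
    then have "quad_class (\<Oplus>\<^bsub>UP R\<^esub>i \<in> {..Suc n}. monom (UP R) (coeff (UP R) p i) i) =
      quad_class (monom (UP R) (coeff (UP R) p (Suc n)) (Suc n)) \<oplus>\<^bsub>?B\<^esub>
      quad_class (\<Oplus>\<^bsub>UP R\<^esub>i \<in> {..n}. monom (UP R) (coeff (UP R) p i) i)"
      using p(1) by (simp only: q.hom_add UP.monom_closed UP.coeff_closed UP.finsum_closed Pi_I)
    then show ?case using S_add[OF S_power Suc.IH] p(1) by (simp only: UP.coeff_closed)
  qed
  from this[of "deg R p"] have "y \<in> ?S" unfolding UP.up_repr[OF p(1)] p(2) .
  then show ?thesis by blast
qed

lemma quad_ext_linear:
  assumes "y \<in> carrier (quad_ext R a b)"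
  shows "\<exists>r \<in> carrier R. \<exists>s \<in> carrier R.
    y = quad_class (monom (UP R) r 0 \<oplus>\<^bsub>UP R\<^esub> monom (UP R) s 1)"
proof -
  interpret q: ring_hom_cring "UP R" "quad_ext R a b" quad_class by (rule quad_class_hom_cring)
  have "quad_const r \<oplus>\<^bsub>quad_ext R a b\<^esub> quad_const s \<otimes>\<^bsub>quad_ext R a b\<^esub> quad_gen =
      quad_class (monom (UP R) r 0 \<oplus>\<^bsub>UP R\<^esub> monom (UP R) s 1)"
    if "r \<in> carrier R" "s \<in> carrier R" for r s
    using that UP.monom_mult[OF that(2) one_closed, of 0 1] by (simp flip: q.hom_mult)
  then show ?thesis using quad_ext_basis[OF assms] by metis
qed

text \<open>The quadratic polynomial is monic, so a multiple \<open>h (t\<^sup>2 + a t + b)\<close> has the leading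
  coefficient of \<open>h\<close> in degree \<open>deg h + 2\<close>. If that coefficient is zero, so is
  \<open>h\<close>.\<close>

lemma quad_ideal_low_degree:
  assumes p: "p \<in> quad_ideal R a b" and low: "\<And>k. 2 \<le> k \<Longrightarrow> coeff (UP R) p k = \<zero>"
  shows "p = \<zero>\<^bsub>UP R\<^esub>"
proof -
  obtain h where h: "h \<in> carrier (UP R)" "p = h \<otimes>\<^bsub>UP R\<^esub> quad_poly R a b"
    using p by (auto simp: quad_ideal_def cgenideal_def)
  have "coeff (UP R) h (deg R h) = coeff (UP R) h (deg R h) \<otimes> coeff (UP R) (quad_poly R a b) 2"
    using h(1) a b by (simp add: quad_poly_def)
  also have "\<dots> = coeff (UP R) p (deg R h + 2)"
    unfolding h(2)
    by (rule UP.coeff_mult_top[symmetric])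
      (use h(1) a b in \<open>auto simp: quad_poly_def UP.deg_aboveD\<close>)
  also have "\<dots> = \<zero>" by (rule low) simp
  finally have "h = \<zero>\<^bsub>UP R\<^esub>" using UP.lcoeff_nonzero2 h(1) by blast
  then show ?thesis using h quad_poly_closed by simp
qed

text \<open>The quadratic extension is free over \<open>R\<close> with basis \<open>1\<close>, \<open>t\<close>, so
  multiplication by a constant acts on each coordinate separately.\<close>

lemma quad_const_regular:
  assumes s: "s \<in> regular_elems R"
  shows "quad_const s \<in> regular_elems (quad_ext R a b)"
proof -
  interpret q: ring_hom_cring "UP R" "quad_ext R a b" quad_class by (rule quad_class_hom_cring)
  have sc: "s \<in> carrier R" using s by (rule regular_elems_closed)
  have "y = \<zero>\<^bsub>quad_ext R a b\<^esub>"
    if y: "y \<in> carrier (quad_ext R a b)" "quad_const s \<otimes>\<^bsub>quad_ext R a b\<^esub> y = \<zero>\<^bsub>quad_ext R a b\<^esub>" for y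
  proof -
    obtain r r' where r: "r \<in> carrier R" "r' \<in> carrier R"
      "y = quad_class (monom (UP R) r 0 \<oplus>\<^bsub>UP R\<^esub> monom (UP R) r' 1)"
      using quad_ext_linear[OF y(1)] by blast
    let ?w = "monom (UP R) r 0 \<oplus>\<^bsub>UP R\<^esub> monom (UP R) r' 1"
    have w: "?w \<in> carrier (UP R)" using r by simp
    have sw: "s \<odot>\<^bsub>UP R\<^esub> ?w \<in> carrier (UP R)" using sc w by simp
    have "quad_class (s \<odot>\<^bsub>UP R\<^esub> ?w) = \<zero>\<^bsub>quad_ext R a b\<^esub>"
      using y(2) sc w unfolding r(3) by (simp flip: UP.monom_mult_is_smult del: UP.monom_mult)
    then have "s \<odot>\<^bsub>UP R\<^esub> ?w \<in> quad_ideal R a b" using sw by (simp add: quad_class_eq_zero_iff)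
    then have 0: "s \<odot>\<^bsub>UP R\<^esub> ?w = \<zero>\<^bsub>UP R\<^esub>"
      by (rule quad_ideal_low_degree) (use r sc in simp)
    have "coeff (UP R) (s \<odot>\<^bsub>UP R\<^esub> ?w) i = \<zero>" for i unfolding 0 by simp
    from this[of 0] this[of 1] have "s \<otimes> r = \<zero>" "s \<otimes> r' = \<zero>" using r sc by simp_all
    then have "r = \<zero>" "r' = \<zero>" using regular_elemsD[OF s] r by auto
    then show ?thesis using r(3) by simp
  qed
  then show ?thesis using sc unfolding regular_elems_def by simp
qed

lemma rees_I_linear:
  assumes "r \<in> carrier R" "i \<in> I"
  shows "monom (UP R) r 0 \<oplus>\<^bsub>UP R\<^esub> monom (UP R) i 1 \<in> carrier Rees"
proof -
  interpret M: comm_monoid "ideals_set R" by (rule ideals_set_is_comm_monoid)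
  have pow: "I [^]\<^bsub>ideals_set R\<^esub> (0::nat) = carrier R" "I [^]\<^bsub>ideals_set R\<^esub> (1::nat) = I"
    using I M.nat_pow_eone[of I] by (simp_all add: ideals_set_def)
  have i: "i \<in> carrier R" using ideal.Icarr[OF I assms(2)] .
  have "coeff (UP R) (monom (UP R) r 0 \<oplus>\<^bsub>UP R\<^esub> monom (UP R) i 1) n \<in> I [^]\<^bsub>ideals_set R\<^esub> n" for n
  proof -
    consider "n = 0" | "n = 1" | "2 \<le> n" by linarith
    then show ?thesis
      using assms i pow additive_subgroup.zero_closed[OF ideal.axioms(1)[OF power_ideal, of n]]
      by cases simp_all
  qed
  then show ?thesis using assms(1) i by (simp add: rees_carrier_iff)
qed

section \<open>The quotient of the Rees algebra\<close>

definition rees_const :: "'a \<Rightarrow> (nat \<Rightarrow> 'a) set"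
  where "rees_const r = J +>\<^bsub>Rees\<^esub> monom (UP R) r 0"

lemma const_in_rees:
  assumes "r \<in> carrier R"
  shows "monom (UP R) r 0 \<in> carrier Rees"
  using rees_I_linear[OF assms additive_subgroup.zero_closed[OF ideal.axioms(1)[OF I]]] assms
  by simp

lemma rees_const_hom: "rees_const \<in> ring_hom R (rees_quot R I a b)"
proof -
  have "(\<lambda>r. monom (UP R) r 0) \<in> ring_hom R Rees"
    using UP.const_ring_hom const_in_rees
    unfolding ring_hom_def by (simp add: rees_add rees_mult rees_one)
  from ring_hom_trans[OF this ideal.rcos_ring_hom[OF J_ideal]] show ?thesis
    by (simp add: rees_const_def[abs_def] comp_def rees_quot_def)
qed

lemma rees_incl_const: "r \<in> carrier R \<Longrightarrow> rees_incl R a b (rees_const r) = quad_const r"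
  by (simp add: rees_const_def rees_incl_coset const_in_rees quad_class_def)

text \<open>Multiplying \<open>r + r' t\<close> by an element of \<open>I\<close> moves the coefficient of
  \<open>t\<close> into \<open>I\<close>, as membership in the Rees algebra requires.\<close>

lemma conductor_rees_incl:
  assumes s: "s \<in> I" and y: "y \<in> carrier (quad_ext R a b)"
  shows "quad_const s \<otimes>\<^bsub>quad_ext R a b\<^esub> y \<in> rees_incl R a b ` carrier (rees_quot R I a b)"
proof -
  interpret q: ring_hom_cring "UP R" "quad_ext R a b" quad_class by (rule quad_class_hom_cring)
  have sc: "s \<in> carrier R" using ideal.Icarr[OF I s] .
  obtain r r' where r: "r \<in> carrier R" "r' \<in> carrier R"
    "y = quad_class (monom (UP R) r 0 \<oplus>\<^bsub>UP R\<^esub> monom (UP R) r' 1)"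
    using quad_ext_linear[OF y] by blast
  let ?p = "monom (UP R) (s \<otimes> r) 0 \<oplus>\<^bsub>UP R\<^esub> monom (UP R) (s \<otimes> r') 1"
  have eq: "quad_const s \<otimes>\<^bsub>quad_ext R a b\<^esub> y = quad_class ?p"
    unfolding r(3) using UP.monom_mult[OF sc r(1), of 0 0] UP.monom_mult[OF sc r(2), of 0 1] r sc
    by (simp add: UP.r_distr del: q.hom_add flip: q.hom_mult)
  have "?p \<in> carrier Rees"
    using r sc ideal.I_r_closed[OF I s r(2)] by (intro rees_I_linear) simp_all
  then have "quad_class ?p = rees_incl R a b (J +>\<^bsub>Rees\<^esub> ?p)"
    "J +>\<^bsub>Rees\<^esub> ?p \<in> carrier (rees_quot R I a b)"
    by (auto simp only: rees_incl_coset quad_class_def rees_quot_carrier)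
  then show ?thesis unfolding eq by (rule image_eqI)
qed

lemma regular_conductor_rees_incl:
  assumes "s \<in> I" "s \<in> regular_elems R"
  shows "regular_conductor (rees_quot R I a b) (quad_ext R a b) (rees_incl R a b) (rees_const s)"
proof -
  have s: "s \<in> carrier R" using assms(2) by (rule regular_elems_closed)
  show ?thesis
    unfolding regular_conductor_def regular_conductor_axioms_def rees_incl_const[OF s]
    using rees_quot_cring quad_ext_cring rees_incl_hom rees_incl_inj
      ring_hom_closed[OF rees_const_hom s] quad_const_regular[OF assms(2)]
      conductor_rees_incl[OF assms(1)] by blast
qed

text \<open>The homomorphism is factored through the Rees quotient because the coefficients in \<open>R\<close>
  are to be read as elements of that ring.\<close>

lemma integral_closure_quad_ext_over_base:
  assumes w: "w \<in> integral_closure (quad_ext R a b)"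
  shows "integral_over R (total_frac (quad_ext R a b))
    (to_total_frac (quad_ext R a b) \<circ> rees_incl R a b \<circ> rees_const) w"
proof -
  interpret B: cring "quad_ext R a b" by (rule quad_ext_cring)
  interpret q: ring_hom_cring "UP R" "quad_ext R a b" quad_class by (rule quad_class_hom_cring)
  have "integral_over R (total_frac (quad_ext R a b))
      (to_total_frac (quad_ext R a b) \<circ> (\<lambda>r. quad_const r)) w"
  proof (rule integral_over_quadratic_descent[OF is_cring B.is_cring B.total_frac_cring
        quad_const_hom B.to_total_frac_hom a b _ quad_gen_root])
    show "quad_gen \<in> carrier (quad_ext R a b)" by simp
    show "integral_over (quad_ext R a b) (total_frac (quad_ext R a b))
        (to_total_frac (quad_ext R a b)) w"
      using w by (simp add: integral_closure_def)
  qed (rule quad_ext_basis)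
  then show ?thesis
    by (subst integral_over_cong[OF is_cring B.total_frac_cring
          ring_hom_trans[OF quad_const_hom B.to_total_frac_hom]])
      (simp_all add: rees_incl_const)
qed

end

section \<open>Total rings of fractions and integral closures\<close>

theorem corollary1p8:
  fixes R :: "('a, 'm) ring_scheme" (structure)
  assumes "cring R"
    and "ideal I R" and "I \<noteq> carrier R"
    and "I \<inter> regular_elems R \<noteq> {}"
    and "a \<in> carrier R" and "b \<in> carrier R"
  shows "\<exists>\<Psi> \<in> ring_iso (total_frac (rees_quot R I a b)) (total_frac (quad_ext R a b)).
    (\<forall>x \<in> carrier (rees_quot R I a b).
      \<Psi> (to_total_frac (rees_quot R I a b) x) =
        to_total_frac (quad_ext R a b) (rees_incl R a b x)) \<and>
    \<Psi> ` integral_closure (rees_quot R I a b) = integral_closure (quad_ext R a b)"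
proof -
  interpret rees_setup R I a b
    using assms by (simp add: rees_setup_def rees_setup_axioms_def)
  obtain s where "s \<in> I" "s \<in> regular_elems R" using assms(4) by blast
  then interpret C: regular_conductor "rees_quot R I a b" "quad_ext R a b" "rees_incl R a b"
    "rees_const s" by (rule regular_conductor_rees_incl)
  show ?thesis
    using C.frac_map_iso C.frac_map_to_total_frac
      C.frac_map_integral_closure[OF is_cring rees_const_hom integral_closure_quad_ext_over_base]
    by blast
qed

end
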